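(* Let $P_3$ be the monad on the category $\mathbf{RGSet}_3$ of $3$-dimensional reflexive globular sets described in the context (so that a Penon $3$-category is a $P_3$-algebra), and let $\theta : P_3A \to A$ be a $P_3$-algebra which is doubly degenerate, i.e. $A$ has exactly one $0$-cell and exactly one $1$-cell. Write $\eta_A : A \to P_3A$ for the unit, $\phi : P_3A \to T_RA$ for the canonical map to the free strict $3$-category on the reflexive globular set $A$, and write $\alpha$ also for $\eta_A(\alpha)$. Then for all $2$-cells $\alpha,\beta \in A(2)$ one has $\phi(\alpha\circ_1\beta)=\phi(\beta\circ_1\alpha)$ in $T_RA$, so that the contraction $3$-cell $[\alpha\circ_1\beta,\ \beta\circ_1\alpha]$ exists in $P_3A$. Moreover, the following data define a braided monoidal category: - objects: the elements of $A(2)$; morphisms: the elements of $A(3)$, with source, target, and identities given by $s,t,i$ and composition of $f:\alpha\to\beta$ and $g:\beta\to\gamma$ given by $\theta(g\circ_2 f)$; - tensor product: $\alpha\otimes\beta=\theta(\alpha\circ_1\beta)$ on objects and $f\otimes g=\theta(f\circ_1 g)$ on morphisms, with unit object the putative identity $i(e)$ on the unique $1$-cell $e$; - associativity and unit constraints: the images under $\theta$ of the contraction $3$-cells $[(\alpha\circ_1\beta)\circ_1\gamma,\ \alpha\circ_1(\beta\circ_1\gamma)]$, $[i(e)\circ_1\alpha,\ \alpha]$ and $[\alpha\circ_1 i(e),\ \alpha]$ of $P_3A$; - braiding: $\gamma_{\alpha,\beta}=\theta\big([\alpha\circ_1\beta,\ \beta\circ_1\alpha]\big):\alpha\otimes\beta\to\beta\otimes\alpha$.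 Furthermore, this braiding is a symmetry: $\gamma_{\beta,\alpha}\circ\gamma_{\alpha,\beta}=1_{\alpha\otimes\beta}$ for all $\alpha,\beta\in A(2)$.
   Context: A $3$-dimensional reflexive globular set $A$ consists of sets $A(0),A(1),A(2),A(3)$ (elements of $A(k)$ are called $k$-cells), maps $s,t:A(k)\to A(k-1)$ for $1\le k\le 3$, and maps $i:A(k)\to A(k+1)$ for $0\le k\le 2$, with $ss=st$, $ts=tt$, $si=ti=1$. Maps of reflexive globular sets commute with $s,t,i$; the resulting category is $\mathbf{RGSet}_3$. A ($3$-dimensional) magma is a $3$-dimensional reflexive globular set with, for all $1\le m\le 3$ and $0\le k\le m-1$, and all $\alpha,\beta\in A(m)$ with $t^{m-k}\alpha=s^{m-k}\beta$, a chosen composite $\beta\circ_k\alpha\in A(m)$ such that: if $k<m-1$ then $s(\beta\circ_k\alpha)=s(\beta)\circ_k s(\alpha)$ and $t(\beta\circ_k\alpha)=t(\beta)\circ_k t(\alpha)$; if $k=m-1$ then $s(\beta\circ_k\alpha)=s(\alpha)$ and $t(\beta\circ_k\alpha)=t(\beta)$. No further axioms are imposed. Maps of magmas are maps of reflexive globular sets preserving all composites. Every strict $3$-category has an underlying magma (with $i$ giving identities). Two $k$-cells $\alpha,\beta$ are parallel if $k=0$, or $k\ge1$ and $s\alpha=s\beta$, $t\alpha=t\beta$. A contraction $[\ ,\ ]$ on a map $f:A\to B$ of $3$-dimensional reflexive globular sets gives, for each $k<3$ and each pair of parallel $k$-cells $\alpha,\beta$ of $A$ with $f\alpha=f\beta$,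 a $(k+1)$-cell $[\alpha,\beta]$ with source $\alpha$ and target $\beta$ such that $f[\alpha,\beta]=i(f\alpha)$ and $[\alpha,\alpha]=i\alpha$; and for $k=3$ it is required that any parallel $3$-cells $\alpha,\beta$ with $f\alpha=f\beta$ are equal. The category $\mathcal{Q}$ has as objects quadruples $(A,B,f,[\ ,\ ])$ where $A$ is a magma, $B$ is a strict $3$-category, $f:A\to B$ is a map of magmas, and $[\ ,\ ]$ is a contraction on $f$. A morphism to $(A',B',f',[\ ,\ ])$ is a pair $(g_1,g_2)$ with $g_1:A\to A'$ a map of magmas, $g_2:B\to B'$ a strict $3$-functor, $f'g_1=g_2f$ and $g_1[\alpha,\beta]=[g_1\alpha,g_1\beta]$ for every contraction cell. The forgetful functor $U:\mathcal{Q}\to\mathbf{RGSet}_3$, $(A,B,f,[\ ,\ ])\mapsto A$, has a left adjoint $F$; $P_3=UF$ is the induced monad. For $A\in\mathbf{RGSet}_3$, $FA$ has the form $(P_3A,\ T_RA,\ \phi,\ [\ ,\ ])$ where $T_RA$ is the free strict $3$-category on the reflexive globular set $A$ (so putative identities $i(x)$ in $A$ become actual identities in $T_RA$). In particular $P_3A$ carries a magma structure and contraction cells. *)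

theory Defs
  imports Main
begin

section \<open>Reflexive globular sets, magmas and strict 3-categories\<close>

text \<open>
  The sets of k-cells of a structure are subsets of one type and need not be disjoint, so each
  operation carries the dimension of its arguments: \<open>src A k\<close> and \<open>tgt A k\<close> act on k-cells
  (for k in 1..3), \<open>idn A k\<close> acts on k-cells (for k in 0..2), and \<open>cmp A m k \<beta> \<alpha>\<close> is the composite
  of the m-cells \<open>\<beta>\<close> and \<open>\<alpha>\<close> along k-cells, with \<open>\<alpha>\<close> first. Values off the cells are irrelevant.
\<close>

record 'u rgset =
  cell :: "nat \<Rightarrow> 'u set"
  src :: "nat \<Rightarrow> 'u \<Rightarrow> 'u"
  tgt :: "nat \<Rightarrow> 'u \<Rightarrow> 'u"
  idn :: "nat \<Rightarrow> 'u \<Rightarrow> 'u"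

record 'u magma = "'u rgset" +
  cmp :: "nat \<Rightarrow> nat \<Rightarrow> 'u \<Rightarrow> 'u \<Rightarrow> 'u"

definition reflexive_globular_set :: "('u, 'z) rgset_scheme \<Rightarrow> bool" where
  "reflexive_globular_set A \<longleftrightarrow>
     (\<forall>k\<in>{1..3}. \<forall>x\<in>cell A k. src A k x \<in> cell A (k - 1) \<and> tgt A k x \<in> cell A (k - 1)) \<and>
     (\<forall>k\<le>2. \<forall>x\<in>cell A k. idn A k x \<in> cell A (k + 1)) \<and>
     (\<forall>k\<in>{2..3}. \<forall>x\<in>cell A k.
        src A (k - 1) (src A k x) = src A (k - 1) (tgt A k x) \<and>
        tgt A (k - 1) (src A k x) = tgt A (k - 1) (tgt A k x)) \<and>
     (\<forall>k\<le>2. \<forall>x\<in>cell A k. src A (k + 1) (idn A k x) = x \<and> tgt A (k + 1) (idn A k x) = x)"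

definition rgset_map ::
    "('u, 'y) rgset_scheme \<Rightarrow> ('u, 'z) rgset_scheme \<Rightarrow> (nat \<Rightarrow> 'u \<Rightarrow> 'u) \<Rightarrow> bool" where
  "rgset_map A B f \<longleftrightarrow>
     (\<forall>k\<le>3. \<forall>x\<in>cell A k. f k x \<in> cell B k) \<and>
     (\<forall>k\<in>{1..3}. \<forall>x\<in>cell A k.
        f (k - 1) (src A k x) = src B k (f k x) \<and> f (k - 1) (tgt A k x) = tgt B k (f k x)) \<and>
     (\<forall>k\<le>2. \<forall>x\<in>cell A k. f (k + 1) (idn A k x) = idn B k (f k x))"

text \<open>
  \<open>isrc A m j\<close> and \<open>itgt A m j\<close> are the j-fold source and target of an m-cell;
  \<open>iidn A k j\<close> is the j-fold identity on a k-cell.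
\<close>

primrec isrc :: "('u, 'z) rgset_scheme \<Rightarrow> nat \<Rightarrow> nat \<Rightarrow> 'u \<Rightarrow> 'u" where
  "isrc A m 0 x = x"
| "isrc A m (Suc j) x = src A (m - j) (isrc A m j x)"

primrec itgt :: "('u, 'z) rgset_scheme \<Rightarrow> nat \<Rightarrow> nat \<Rightarrow> 'u \<Rightarrow> 'u" where
  "itgt A m 0 x = x"
| "itgt A m (Suc j) x = tgt A (m - j) (itgt A m j x)"

primrec iidn :: "('u, 'z) rgset_scheme \<Rightarrow> nat \<Rightarrow> nat \<Rightarrow> 'u \<Rightarrow> 'u" where
  "iidn A k 0 x = x"
| "iidn A k (Suc j) x = idn A (k + j) (iidn A k j x)"

definition composable :: "('u, 'z) rgset_scheme \<Rightarrow> nat \<Rightarrow> nat \<Rightarrow> 'u \<Rightarrow> 'u \<Rightarrow> bool" where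
  "composable A m k \<beta> \<alpha> \<longleftrightarrow>
     \<beta> \<in> cell A m \<and> \<alpha> \<in> cell A m \<and> itgt A m (m - k) \<alpha> = isrc A m (m - k) \<beta>"

definition is_magma :: "'u magma \<Rightarrow> bool" where
  "is_magma A \<longleftrightarrow> reflexive_globular_set A \<and>
     (\<forall>m\<in>{1..3}. \<forall>k<m. \<forall>\<alpha> \<beta>. composable A m k \<beta> \<alpha> \<longrightarrow>
        cmp A m k \<beta> \<alpha> \<in> cell A m \<and>
        (k < m - 1 \<longrightarrow>
           src A m (cmp A m k \<beta> \<alpha>) = cmp A (m - 1) k (src A m \<beta>) (src A m \<alpha>) \<and>
           tgt A m (cmp A m k \<beta> \<alpha>) = cmp A (m - 1) k (tgt A m \<beta>) (tgt A m \<alpha>)) \<and>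
        (k = m - 1 \<longrightarrow>
           src A m (cmp A m k \<beta> \<alpha>) = src A m \<alpha> \<and>
           tgt A m (cmp A m k \<beta> \<alpha>) = tgt A m \<beta>))"

definition magma_map :: "'u magma \<Rightarrow> 'u magma \<Rightarrow> (nat \<Rightarrow> 'u \<Rightarrow> 'u) \<Rightarrow> bool" where
  "magma_map A B f \<longleftrightarrow> rgset_map A B f \<and>
     (\<forall>m\<in>{1..3}. \<forall>k<m. \<forall>\<alpha> \<beta>. composable A m k \<beta> \<alpha> \<longrightarrow>
        f m (cmp A m k \<beta> \<alpha>) = cmp B m k (f m \<beta>) (f m \<alpha>))"

text \<open>
  A strict 3-category is represented by its underlying magma. Strict 3-functors are then the same
  as magma maps, since both preserve sources, targets, identities and all composites.
\<close>

definition strict_3_category :: "'u magma \<Rightarrow> bool" where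
  "strict_3_category A \<longleftrightarrow> is_magma A \<and>
     (\<forall>m\<in>{1..3}. \<forall>k<m. \<forall>\<alpha> \<beta> \<gamma>. composable A m k \<beta> \<alpha> \<and> composable A m k \<gamma> \<beta> \<longrightarrow>
        cmp A m k (cmp A m k \<gamma> \<beta>) \<alpha> = cmp A m k \<gamma> (cmp A m k \<beta> \<alpha>)) \<and>
     (\<forall>m\<in>{1..3}. \<forall>k<m. \<forall>\<alpha>\<in>cell A m.
        cmp A m k \<alpha> (iidn A k (m - k) (isrc A m (m - k) \<alpha>)) = \<alpha> \<and>
        cmp A m k (iidn A k (m - k) (itgt A m (m - k) \<alpha>)) \<alpha> = \<alpha>) \<and>
     (\<forall>m\<in>{1..2}. \<forall>k<m. \<forall>\<alpha> \<beta>. composable A m k \<beta> \<alpha> \<longrightarrow>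
        idn A m (cmp A m k \<beta> \<alpha>) = cmp A (m + 1) k (idn A m \<beta>) (idn A m \<alpha>)) \<and>
     (\<forall>m\<in>{1..3}. \<forall>k<m. \<forall>j<k. \<forall>\<alpha> \<beta> \<gamma> \<delta>.
        composable A m k \<beta> \<alpha> \<and> composable A m k \<delta> \<gamma> \<and>
        composable A m j \<gamma> \<alpha> \<and> composable A m j \<delta> \<beta> \<longrightarrow>
        cmp A m j (cmp A m k \<delta> \<gamma>) (cmp A m k \<beta> \<alpha>) =
        cmp A m k (cmp A m j \<delta> \<beta>) (cmp A m j \<gamma> \<alpha>))"

abbreviation strict_3_functor :: "'u magma \<Rightarrow> 'u magma \<Rightarrow> (nat \<Rightarrow> 'u \<Rightarrow> 'u) \<Rightarrow> bool" where
  "strict_3_functor \<equiv> magma_map"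


section \<open>Contractions and the category Q\<close>

definition parallel :: "('u, 'z) rgset_scheme \<Rightarrow> nat \<Rightarrow> 'u \<Rightarrow> 'u \<Rightarrow> bool" where
  "parallel A k \<alpha> \<beta> \<longleftrightarrow> k = 0 \<or> (src A k \<alpha> = src A k \<beta> \<and> tgt A k \<alpha> = tgt A k \<beta>)"

text \<open>\<open>contr_pair A f k \<alpha> \<beta>\<close> says that \<open>(\<alpha>, \<beta>)\<close> lies in the domain of a contraction on \<open>f\<close>.\<close>

definition contr_pair ::
    "('u, 'y) rgset_scheme \<Rightarrow> (nat \<Rightarrow> 'u \<Rightarrow> 'u) \<Rightarrow> nat \<Rightarrow> 'u \<Rightarrow> 'u \<Rightarrow> bool" where
  "contr_pair A f k \<alpha> \<beta> \<longleftrightarrow>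
     \<alpha> \<in> cell A k \<and> \<beta> \<in> cell A k \<and> parallel A k \<alpha> \<beta> \<and> f k \<alpha> = f k \<beta>"

definition contraction ::
    "('u, 'y) rgset_scheme \<Rightarrow> ('u, 'z) rgset_scheme \<Rightarrow> (nat \<Rightarrow> 'u \<Rightarrow> 'u) \<Rightarrow>
     (nat \<Rightarrow> 'u \<Rightarrow> 'u \<Rightarrow> 'u) \<Rightarrow> bool" where
  "contraction A B f c \<longleftrightarrow>
     (\<forall>k<3. \<forall>\<alpha> \<beta>. contr_pair A f k \<alpha> \<beta> \<longrightarrow>
        c k \<alpha> \<beta> \<in> cell A (k + 1) \<and>
        src A (k + 1) (c k \<alpha> \<beta>) = \<alpha> \<and> tgt A (k + 1) (c k \<alpha> \<beta>) = \<beta> \<and>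
        f (k + 1) (c k \<alpha> \<beta>) = idn B k (f k \<alpha>)) \<and>
     (\<forall>k<3. \<forall>\<alpha>\<in>cell A k. c k \<alpha> \<alpha> = idn A k \<alpha>) \<and>
     (\<forall>\<alpha> \<beta>. contr_pair A f 3 \<alpha> \<beta> \<longrightarrow> \<alpha> = \<beta>)"

record 'u quad =
  mag :: "'u magma"
  cat :: "'u magma"
  qmap :: "nat \<Rightarrow> 'u \<Rightarrow> 'u"
  contr :: "nat \<Rightarrow> 'u \<Rightarrow> 'u \<Rightarrow> 'u"

definition Q_object :: "'u quad \<Rightarrow> bool" where
  "Q_object X \<longleftrightarrow> is_magma (mag X) \<and> strict_3_category (cat X) \<and>
     magma_map (mag X) (cat X) (qmap X) \<and> contraction (mag X) (cat X) (qmap X) (contr X)"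

definition Q_morphism ::
    "'u quad \<Rightarrow> 'u quad \<Rightarrow> (nat \<Rightarrow> 'u \<Rightarrow> 'u) \<times> (nat \<Rightarrow> 'u \<Rightarrow> 'u) \<Rightarrow> bool" where
  "Q_morphism X Y g \<longleftrightarrow>
     magma_map (mag X) (mag Y) (fst g) \<and> strict_3_functor (cat X) (cat Y) (snd g) \<and>
     (\<forall>k\<le>3. \<forall>x\<in>cell (mag X) k. qmap Y k (fst g k x) = snd g k (qmap X k x)) \<and>
     (\<forall>k<3. \<forall>\<alpha> \<beta>. contr_pair (mag X) (qmap X) k \<alpha> \<beta> \<longrightarrow>
        fst g (k + 1) (contr X k \<alpha> \<beta>) = contr Y k (fst g k \<alpha>) (fst g k \<beta>))"

definition Q_morphism_eq ::
    "'u quad \<Rightarrow> (nat \<Rightarrow> 'u \<Rightarrow> 'u) \<times> (nat \<Rightarrow> 'u \<Rightarrow> 'u) \<Rightarrow>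
     (nat \<Rightarrow> 'u \<Rightarrow> 'u) \<times> (nat \<Rightarrow> 'u \<Rightarrow> 'u) \<Rightarrow> bool" where
  "Q_morphism_eq X g h \<longleftrightarrow>
     (\<forall>k\<le>3. (\<forall>x\<in>cell (mag X) k. fst g k x = fst h k x) \<and>
            (\<forall>y\<in>cell (cat X) k. snd g k y = snd h k y))"

definition forget :: "'u quad \<Rightarrow> 'u rgset" where
  "forget X = rgset.truncate (mag X)"


section \<open>The monad of the adjunction and its algebras\<close>

text \<open>
  The type \<open>'u\<close> plays the role of the universe of sets: reflexive globular sets and objects of Q
  have their cells in \<open>'u\<close>. The free object on \<open>A\<close> has at most max(card A, aleph-0) cells, so on
  every infinite type a left adjoint of \<open>forget\<close> exists. A left adjoint is given by a universal
  arrow \<open>\<eta> A\<close> from each \<open>A\<close> to \<open>forget\<close>; it is unique up to unique isomorphism, and its action on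
  morphisms and its counit are determined by universality.
\<close>

definition left_adjoint ::
    "('u rgset \<Rightarrow> 'u quad) \<Rightarrow> ('u rgset \<Rightarrow> nat \<Rightarrow> 'u \<Rightarrow> 'u) \<Rightarrow> bool" where
  "left_adjoint F \<eta> \<longleftrightarrow>
     (\<forall>A. reflexive_globular_set A \<longrightarrow>
        Q_object (F A) \<and> rgset_map A (forget (F A)) (\<eta> A) \<and>
        (\<forall>X f. Q_object X \<and> rgset_map A (forget X) f \<longrightarrow>
           (\<exists>g. Q_morphism (F A) X g \<and> (\<forall>k\<le>3. \<forall>a\<in>cell A k. fst g k (\<eta> A k a) = f k a) \<and>
              (\<forall>h. Q_morphism (F A) X h \<and> (\<forall>k\<le>3. \<forall>a\<in>cell A k. fst h k (\<eta> A k a) = f k a) \<longrightarrow>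
                 Q_morphism_eq (F A) g h))))"

text \<open>The morphism \<open>F A \<rightarrow> X\<close> corresponding to \<open>f : A \<rightarrow> forget X\<close>.\<close>

definition adjunct ::
    "('u rgset \<Rightarrow> 'u quad) \<Rightarrow> ('u rgset \<Rightarrow> nat \<Rightarrow> 'u \<Rightarrow> 'u) \<Rightarrow> 'u rgset \<Rightarrow> 'u quad \<Rightarrow>
     (nat \<Rightarrow> 'u \<Rightarrow> 'u) \<Rightarrow> (nat \<Rightarrow> 'u \<Rightarrow> 'u) \<times> (nat \<Rightarrow> 'u \<Rightarrow> 'u)" where
  "adjunct F \<eta> A X f =
     (SOME g. Q_morphism (F A) X g \<and> (\<forall>k\<le>3. \<forall>a\<in>cell A k. fst g k (\<eta> A k a) = f k a))"

definition P3 :: "('u rgset \<Rightarrow> 'u quad) \<Rightarrow> 'u rgset \<Rightarrow> 'u rgset" where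
  "P3 F A = forget (F A)"

definition P3_map ::
    "('u rgset \<Rightarrow> 'u quad) \<Rightarrow> ('u rgset \<Rightarrow> nat \<Rightarrow> 'u \<Rightarrow> 'u) \<Rightarrow> 'u rgset \<Rightarrow> 'u rgset \<Rightarrow>
     (nat \<Rightarrow> 'u \<Rightarrow> 'u) \<Rightarrow> nat \<Rightarrow> 'u \<Rightarrow> 'u" where
  "P3_map F \<eta> A B f = fst (adjunct F \<eta> A (F B) (\<lambda>k a. \<eta> B k (f k a)))"

definition P3_mult ::
    "('u rgset \<Rightarrow> 'u quad) \<Rightarrow> ('u rgset \<Rightarrow> nat \<Rightarrow> 'u \<Rightarrow> 'u) \<Rightarrow> 'u rgset \<Rightarrow> nat \<Rightarrow> 'u \<Rightarrow> 'u" where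
  "P3_mult F \<eta> A = fst (adjunct F \<eta> (forget (F A)) (F A) (\<lambda>k x. x))"

definition P3_algebra ::
    "('u rgset \<Rightarrow> 'u quad) \<Rightarrow> ('u rgset \<Rightarrow> nat \<Rightarrow> 'u \<Rightarrow> 'u) \<Rightarrow> 'u rgset \<Rightarrow>
     (nat \<Rightarrow> 'u \<Rightarrow> 'u) \<Rightarrow> bool" where
  "P3_algebra F \<eta> A \<theta> \<longleftrightarrow>
     reflexive_globular_set A \<and> rgset_map (P3 F A) A \<theta> \<and>
     (\<forall>k\<le>3. \<forall>a\<in>cell A k. \<theta> k (\<eta> A k a) = a) \<and>
     (\<forall>k\<le>3. \<forall>x\<in>cell (P3 F (P3 F A)) k.
        \<theta> k (P3_mult F \<eta> A k x) = \<theta> k (P3_map F \<eta> (P3 F A) A \<theta> k x))"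

text \<open>\<open>cat (F A)\<close> is the free strict 3-category on \<open>A\<close>:\<close>

definition free_strict_3_category ::
    "'u rgset \<Rightarrow> 'u magma \<Rightarrow> (nat \<Rightarrow> 'u \<Rightarrow> 'u) \<Rightarrow> bool" where
  "free_strict_3_category A T \<iota> \<longleftrightarrow> strict_3_category T \<and> rgset_map A T \<iota> \<and>
     (\<forall>C f. strict_3_category C \<and> rgset_map A C f \<longrightarrow>
        (\<exists>g. strict_3_functor T C g \<and> (\<forall>k\<le>3. \<forall>a\<in>cell A k. g k (\<iota> k a) = f k a) \<and>
           (\<forall>h. strict_3_functor T C h \<and> (\<forall>k\<le>3. \<forall>a\<in>cell A k. h k (\<iota> k a) = f k a) \<longrightarrow>
              (\<forall>k\<le>3. \<forall>y\<in>cell T k. g k y = h k y))))"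

lemma cell_forget [simp]: "cell (forget X) = cell (mag X)"
  and src_forget [simp]: "src (forget X) = src (mag X)"
  and tgt_forget [simp]: "tgt (forget X) = tgt (mag X)"
  and idn_forget [simp]: "idn (forget X) = idn (mag X)"
  by (simp_all add: forget_def rgset.defs)

lemma rgset_map_comp:
  assumes "rgset_map A B f" "rgset_map B C g"
  shows "rgset_map A C (\<lambda>k x. g k (f k x))"
  using assms unfolding rgset_map_def by auto

lemma rgset_map_itgt:
  assumes "rgset_map A B f" "reflexive_globular_set A" "m \<le> 3" "x \<in> cell A m" "j \<le> m"
  shows "itgt A m j x \<in> cell A (m - j) \<and> f (m - j) (itgt A m j x) = itgt B m j (f m x)"
  using assms(5)
proof (induction j)
  case 0
  then show ?case using assms by simp
next
  case (Suc j)
  then have "m - j \<in> {1..3}" using assms by auto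
  moreover have "m - Suc j = m - j - 1" by simp
  ultimately show ?case using Suc assms unfolding rgset_map_def reflexive_globular_set_def
    by (metis Suc_leD itgt.simps(2))
qed

lemma rgset_map_isrc:
  assumes "rgset_map A B f" "reflexive_globular_set A" "m \<le> 3" "x \<in> cell A m" "j \<le> m"
  shows "isrc A m j x \<in> cell A (m - j) \<and> f (m - j) (isrc A m j x) = isrc B m j (f m x)"
  using assms(5)
proof (induction j)
  case 0
  then show ?case using assms by simp
next
  case (Suc j)
  then have "m - j \<in> {1..3}" using assms by auto
  moreover have "m - Suc j = m - j - 1" by simp
  ultimately show ?case using Suc assms unfolding rgset_map_def reflexive_globular_set_def
    by (metis Suc_leD isrc.simps(2))
qed

lemma composable_map:
  assumes "rgset_map A B f" "reflexive_globular_set A" "m \<le> 3" "composable A m k \<beta> \<alpha>"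
  shows "composable B m k (f m \<beta>) (f m \<alpha>)"
  using assms rgset_map_itgt[OF assms(1-3), of \<alpha> "m - k"]
    rgset_map_isrc[OF assms(1-3), of \<beta> "m - k"]
  unfolding composable_def rgset_map_def by (metis diff_le_self)

lemma magma_map_comp:
  assumes "is_magma A" "magma_map A B f" "magma_map B C g"
  shows "magma_map A C (\<lambda>k x. g k (f k x))"
proof -
  have "composable B m k (f m \<beta>) (f m \<alpha>)"
    if "m \<in> {1..3}" "composable A m k \<beta> \<alpha>" for m k \<alpha> \<beta>
    using that assms composable_map[of A B f m k \<beta> \<alpha>]
    unfolding is_magma_def magma_map_def by auto
  then show ?thesis
    using assms rgset_map_comp[of A B f C g] unfolding magma_map_def by auto
qed

lemma cat_left_adjoint_free:
  assumes adj: "left_adjoint F \<eta>" and A: "reflexive_globular_set A"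
  shows "free_strict_3_category A (cat (F A)) (\<lambda>k a. qmap (F A) k (\<eta> A k a))"
proof -
  let ?X = "F A" and ?\<iota> = "\<lambda>k a. qmap (F A) k (\<eta> A k a)"
  have X: "Q_object ?X" and \<eta>: "rgset_map A (forget ?X) (\<eta> A)"
    using adj[unfolded left_adjoint_def, rule_format, OF A] by simp_all
  have mX: "is_magma (mag ?X)" and \<phi>: "magma_map (mag ?X) (cat ?X) (qmap ?X)"
    using X unfolding Q_object_def by auto
  have \<iota>: "rgset_map A (cat ?X) ?\<iota>"
    using \<eta> \<phi> unfolding magma_map_def rgset_map_def by auto
  have "\<exists>g. strict_3_functor (cat ?X) C g \<and> (\<forall>k\<le>3. \<forall>a\<in>cell A k. g k (?\<iota> k a) = f k a) \<and>
           (\<forall>h. strict_3_functor (cat ?X) C h \<and> (\<forall>k\<le>3. \<forall>a\<in>cell A k. h k (?\<iota> k a) = f k a) \<longrightarrow>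
              (\<forall>k\<le>3. \<forall>y\<in>cell (cat ?X) k. g k y = h k y))"
    if C: "strict_3_category C" and f: "rgset_map A C f" for C f
  proof -
    define Y where "Y = \<lparr>mag = C, cat = C, qmap = (\<lambda>k x. x), contr = (\<lambda>k x y. idn C k x)\<rparr>"
    have Y: "Q_object Y"
      using C unfolding Y_def Q_object_def strict_3_category_def is_magma_def magma_map_def
        rgset_map_def contraction_def contr_pair_def reflexive_globular_set_def by auto
    have fY: "rgset_map A (forget Y) f"
      using f by (simp add: rgset_map_def Y_def)
    obtain g where g: "Q_morphism ?X Y g"
      and gf: "\<forall>k\<le>3. \<forall>a\<in>cell A k. fst g k (\<eta> A k a) = f k a"
      and uniq: "\<And>h. Q_morphism ?X Y h \<Longrightarrow> (\<forall>k\<le>3. \<forall>a\<in>cell A k. fst h k (\<eta> A k a) = f k a)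
                  \<Longrightarrow> Q_morphism_eq ?X g h"
      using adj[unfolded left_adjoint_def, rule_format, OF A, THEN conjunct2, THEN conjunct2,
        rule_format, of Y f] Y fY by auto
    have gfun: "strict_3_functor (cat ?X) C (snd g)"
      using g by (simp add: Q_morphism_def Y_def)
    have g\<phi>: "\<forall>k\<le>3. \<forall>x\<in>cell (mag ?X) k. fst g k x = snd g k (qmap ?X k x)"
      using g by (simp add: Q_morphism_def Y_def)
    have \<eta>c: "\<forall>k\<le>3. \<forall>a\<in>cell A k. \<eta> A k a \<in> cell (mag ?X) k"
      using \<eta> by (simp add: rgset_map_def)
    have 1: "\<forall>k\<le>3. \<forall>a\<in>cell A k. snd g k (?\<iota> k a) = f k a"
      using gf g\<phi> \<eta>c by force
    have "\<forall>k\<le>3. \<forall>y\<in>cell (cat ?X) k. snd g k y = h k y"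
      if h: "strict_3_functor (cat ?X) C h" and hf: "\<forall>k\<le>3. \<forall>a\<in>cell A k. h k (?\<iota> k a) = f k a"
      for h
    proof -
      let ?h = "(\<lambda>k x. h k (qmap ?X k x), h)"
      have con: "qmap ?X (k + 1) (contr ?X k \<alpha> \<beta>) = idn (cat ?X) k (qmap ?X k \<alpha>)
          \<and> qmap ?X k \<alpha> \<in> cell (cat ?X) k"
        if "k < 3" "contr_pair (mag ?X) (qmap ?X) k \<alpha> \<beta>" for k \<alpha> \<beta>
        using that X unfolding Q_object_def contraction_def magma_map_def rgset_map_def
          contr_pair_def by auto
      have hid: "h (k + 1) (idn (cat ?X) k y) = idn C k (h k y)"
        if "k < 3" "y \<in> cell (cat ?X) k" for k y
        using that h unfolding magma_map_def rgset_map_def by auto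
      have "Q_morphism ?X Y ?h"
        unfolding Q_morphism_def using magma_map_comp[OF mX \<phi> h] h con hid
        by (simp add: Y_def)
      then have "Q_morphism_eq ?X g ?h" using uniq[of ?h] hf by simp
      then show ?thesis by (simp add: Q_morphism_eq_def)
    qed
    with gfun 1 show ?thesis by blast
  qed
  then show ?thesis
    using X \<iota> unfolding free_strict_3_category_def Q_object_def by blast
qed


section \<open>Braided monoidal categories\<close>

text \<open>
  \<open>Comp C g f\<close> is \<open>g\<close> after \<open>f\<close>. The coherence axioms are those of Joyal and Street,
  with \<open>Assoc a b c : (a \<otimes> b) \<otimes> c \<rightarrow> a \<otimes> (b \<otimes> c)\<close>.
\<close>

record ('o, 'm) braided_data =
  Obj :: "'o set"
  Mor :: "'m set"
  Dom :: "'m \<Rightarrow> 'o"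
  Cod :: "'m \<Rightarrow> 'o"
  Ident :: "'o \<Rightarrow> 'm"
  Comp :: "'m \<Rightarrow> 'm \<Rightarrow> 'm"
  TensorO :: "'o \<Rightarrow> 'o \<Rightarrow> 'o"
  TensorM :: "'m \<Rightarrow> 'm \<Rightarrow> 'm"
  Unit :: "'o"
  Assoc :: "'o \<Rightarrow> 'o \<Rightarrow> 'o \<Rightarrow> 'm"
  LUnit :: "'o \<Rightarrow> 'm"
  RUnit :: "'o \<Rightarrow> 'm"
  Braid :: "'o \<Rightarrow> 'o \<Rightarrow> 'm"

definition in_hom :: "('o, 'm) braided_data \<Rightarrow> 'm \<Rightarrow> 'o \<Rightarrow> 'o \<Rightarrow> bool" where
  "in_hom C f a b \<longleftrightarrow> f \<in> Mor C \<and> Dom C f = a \<and> Cod C f = b"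

definition iso_in_hom :: "('o, 'm) braided_data \<Rightarrow> 'm \<Rightarrow> 'o \<Rightarrow> 'o \<Rightarrow> bool" where
  "iso_in_hom C f a b \<longleftrightarrow> in_hom C f a b \<and>
     (\<exists>g. in_hom C g b a \<and> Comp C g f = Ident C a \<and> Comp C f g = Ident C b)"

definition Inverse :: "('o, 'm) braided_data \<Rightarrow> 'm \<Rightarrow> 'm" where
  "Inverse C f = (THE g. in_hom C g (Cod C f) (Dom C f) \<and>
     Comp C g f = Ident C (Dom C f) \<and> Comp C f g = Ident C (Cod C f))"

definition is_category :: "('o, 'm) braided_data \<Rightarrow> bool" where
  "is_category C \<longleftrightarrow>
     (\<forall>f\<in>Mor C. Dom C f \<in> Obj C \<and> Cod C f \<in> Obj C) \<and>
     (\<forall>a\<in>Obj C. in_hom C (Ident C a) a a) \<and>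
     (\<forall>f\<in>Mor C. \<forall>g\<in>Mor C. Cod C f = Dom C g \<longrightarrow> in_hom C (Comp C g f) (Dom C f) (Cod C g)) \<and>
     (\<forall>f\<in>Mor C. Comp C f (Ident C (Dom C f)) = f \<and> Comp C (Ident C (Cod C f)) f = f) \<and>
     (\<forall>f\<in>Mor C. \<forall>g\<in>Mor C. \<forall>h\<in>Mor C. Cod C f = Dom C g \<and> Cod C g = Dom C h \<longrightarrow>
        Comp C h (Comp C g f) = Comp C (Comp C h g) f)"

definition tensor_bifunctor :: "('o, 'm) braided_data \<Rightarrow> bool" where
  "tensor_bifunctor C \<longleftrightarrow>
     (\<forall>a\<in>Obj C. \<forall>b\<in>Obj C. TensorO C a b \<in> Obj C) \<and>
     (\<forall>f\<in>Mor C. \<forall>g\<in>Mor C.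
        in_hom C (TensorM C f g) (TensorO C (Dom C f) (Dom C g)) (TensorO C (Cod C f) (Cod C g))) \<and>
     (\<forall>a\<in>Obj C. \<forall>b\<in>Obj C. TensorM C (Ident C a) (Ident C b) = Ident C (TensorO C a b)) \<and>
     (\<forall>f\<in>Mor C. \<forall>g\<in>Mor C. \<forall>f'\<in>Mor C. \<forall>g'\<in>Mor C. Cod C f = Dom C f' \<and> Cod C g = Dom C g' \<longrightarrow>
        TensorM C (Comp C f' f) (Comp C g' g) = Comp C (TensorM C f' g') (TensorM C f g))"

definition monoidal_category :: "('o, 'm) braided_data \<Rightarrow> bool" where
  "monoidal_category C \<longleftrightarrow> is_category C \<and> tensor_bifunctor C \<and> Unit C \<in> Obj C \<and>
     (\<forall>a\<in>Obj C. \<forall>b\<in>Obj C. \<forall>c\<in>Obj C.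
        iso_in_hom C (Assoc C a b c)
          (TensorO C (TensorO C a b) c) (TensorO C a (TensorO C b c))) \<and>
     (\<forall>a\<in>Obj C. iso_in_hom C (LUnit C a) (TensorO C (Unit C) a) a \<and>
                iso_in_hom C (RUnit C a) (TensorO C a (Unit C)) a) \<and>
     (\<forall>f\<in>Mor C. \<forall>g\<in>Mor C. \<forall>h\<in>Mor C.
        Comp C (Assoc C (Cod C f) (Cod C g) (Cod C h)) (TensorM C (TensorM C f g) h) =
        Comp C (TensorM C f (TensorM C g h)) (Assoc C (Dom C f) (Dom C g) (Dom C h))) \<and>
     (\<forall>f\<in>Mor C.
        Comp C (LUnit C (Cod C f)) (TensorM C (Ident C (Unit C)) f) = Comp C f (LUnit C (Dom C f)) \<and>
        Comp C (RUnit C (Cod C f)) (TensorM C f (Ident C (Unit C))) = Comp C f (RUnit C (Dom C f))) \<and>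
     (\<forall>a\<in>Obj C. \<forall>b\<in>Obj C. \<forall>c\<in>Obj C. \<forall>d\<in>Obj C.
        Comp C (Assoc C a b (TensorO C c d)) (Assoc C (TensorO C a b) c d) =
        Comp C (TensorM C (Ident C a) (Assoc C b c d))
          (Comp C (Assoc C a (TensorO C b c) d) (TensorM C (Assoc C a b c) (Ident C d)))) \<and>
     (\<forall>a\<in>Obj C. \<forall>b\<in>Obj C.
        Comp C (TensorM C (Ident C a) (LUnit C b)) (Assoc C a (Unit C) b) =
        TensorM C (RUnit C a) (Ident C b))"

definition braided_monoidal_category :: "('o, 'm) braided_data \<Rightarrow> bool" where
  "braided_monoidal_category C \<longleftrightarrow> monoidal_category C \<and>
     (\<forall>a\<in>Obj C. \<forall>b\<in>Obj C.
        iso_in_hom C (Braid C a b) (TensorO C a b) (TensorO C b a)) \<and>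
     (\<forall>f\<in>Mor C. \<forall>g\<in>Mor C.
        Comp C (Braid C (Cod C f) (Cod C g)) (TensorM C f g) =
        Comp C (TensorM C g f) (Braid C (Dom C f) (Dom C g))) \<and>
     (\<forall>a\<in>Obj C. \<forall>b\<in>Obj C. \<forall>c\<in>Obj C.
        Comp C (Assoc C b c a) (Comp C (Braid C a (TensorO C b c)) (Assoc C a b c)) =
        Comp C (TensorM C (Ident C b) (Braid C a c))
          (Comp C (Assoc C b a c) (TensorM C (Braid C a b) (Ident C c)))) \<and>
     (\<forall>a\<in>Obj C. \<forall>b\<in>Obj C. \<forall>c\<in>Obj C.
        Comp C (Inverse C (Assoc C c a b))
          (Comp C (Braid C (TensorO C a b) c) (Inverse C (Assoc C a b c))) =
        Comp C (TensorM C (Braid C a c) (Ident C b))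
          (Comp C (Inverse C (Assoc C a c b)) (TensorM C (Ident C a) (Braid C b c))))"


section \<open>The data associated with a doubly degenerate algebra\<close>

definition doubly_degenerate :: "('u, 'z) rgset_scheme \<Rightarrow> bool" where
  "doubly_degenerate A \<longleftrightarrow> (\<exists>!x. x \<in> cell A 0) \<and> (\<exists>!e. e \<in> cell A 1)"

definition the_1_cell :: "('u, 'z) rgset_scheme \<Rightarrow> 'u" where
  "the_1_cell A = (THE e. e \<in> cell A 1)"

definition algebra_data ::
    "('u rgset \<Rightarrow> 'u quad) \<Rightarrow> ('u rgset \<Rightarrow> nat \<Rightarrow> 'u \<Rightarrow> 'u) \<Rightarrow> 'u rgset \<Rightarrow>
     (nat \<Rightarrow> 'u \<Rightarrow> 'u) \<Rightarrow> ('u, 'u) braided_data" where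
  "algebra_data F \<eta> A \<theta> =
     (let h = \<eta> A;
          o1 = cmp (mag (F A)) 2 1;
          u = idn A 1 (the_1_cell A);
          con = contr (F A) 2
      in \<lparr>Obj = cell A 2,
          Mor = cell A 3,
          Dom = src A 3,
          Cod = tgt A 3,
          Ident = idn A 2,
          Comp = (\<lambda>g f. \<theta> 3 (cmp (mag (F A)) 3 2 (h 3 g) (h 3 f))),
          TensorO = (\<lambda>a b. \<theta> 2 (o1 (h 2 a) (h 2 b))),
          TensorM = (\<lambda>f g. \<theta> 3 (cmp (mag (F A)) 3 1 (h 3 f) (h 3 g))),
          Unit = u,
          Assoc = (\<lambda>a b c. \<theta> 3 (con (o1 (o1 (h 2 a) (h 2 b)) (h 2 c))
                                    (o1 (h 2 a) (o1 (h 2 b) (h 2 c))))),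
          LUnit = (\<lambda>a. \<theta> 3 (con (o1 (h 2 u) (h 2 a)) (h 2 a))),
          RUnit = (\<lambda>a. \<theta> 3 (con (o1 (h 2 a) (h 2 u)) (h 2 a))),
          Braid = (\<lambda>a b. \<theta> 3 (con (o1 (h 2 a) (h 2 b)) (o1 (h 2 b) (h 2 a))))\<rparr>)"

end

theory Submission
  imports Defs
begin

text \<open>
  Since \<open>A\<close> has a single 1-cell, every 2-cell of \<open>A\<close> is an endocell of an identity 1-cell. The unit
  and \<open>\<phi>\<close> preserve identities, and the identity 1-cells of \<open>T\<^sub>RA\<close> are strict units, so the
  Eckmann--Hilton argument makes \<open>\<circ>\<^sub>1\<close> commutative on the images of the cells of \<open>A\<close> in \<open>T\<^sub>RA\<close>; hence
  the contraction cells for the braiding exist. A 3-cell of \<open>P\<^sub>3A\<close> is determined by its source, its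
  target and its image in \<open>T\<^sub>RA\<close>, and contraction cells are sent to identities there; so every
  diagram built from constraint cells commutes in \<open>P\<^sub>3A\<close>. The algebra law carries this over to \<open>A\<close>:
  a composite or contraction cell formed from evaluated cells is the value of the same cell formed
  before evaluation, which is seen in \<open>P\<^sub>3P\<^sub>3A\<close>, where the contraction cells in question exist for
  the same reason as in \<open>P\<^sub>3A\<close>.
\<close>

(* Keeps the dimension 1 in the form in which it occurs in terms such as cmp A 2 1. *)
declare One_nat_def [simp del] One_nat_def [symmetric, simp]

section \<open>Cells over the identity 1-cell of a point\<close>

text \<open>A free object may have further 1-cells even when \<open>A\<close> has only one, so the
  argument is confined to endocells of the identity 1-cell on a chosen point.\<close>

definition loops2 :: "('u, 'z) rgset_scheme \<Rightarrow> 'u \<Rightarrow> 'u set" where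
  "loops2 A p = {x \<in> cell A 2. src A 2 x = idn A 0 p \<and> tgt A 2 x = idn A 0 p}"

definition loops3 :: "('u, 'z) rgset_scheme \<Rightarrow> 'u \<Rightarrow> 'u set" where
  "loops3 A p = {f \<in> cell A 3. src A 3 f \<in> loops2 A p \<and> tgt A 3 f \<in> loops2 A p}"

abbreviation unit2 :: "('u, 'z) rgset_scheme \<Rightarrow> 'u \<Rightarrow> 'u" where
  "unit2 A p \<equiv> idn A 1 (idn A 0 p)"

lemma reflexive_globular_set_src_tgt:
  assumes "reflexive_globular_set A" "x \<in> cell A k" "1 \<le> k" "k \<le> 3"
  shows "src A k x \<in> cell A (k - 1)" "tgt A k x \<in> cell A (k - 1)"
  using assms unfolding reflexive_globular_set_def by auto

lemma reflexive_globular_set_idn: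
  assumes "reflexive_globular_set A" "x \<in> cell A k" "k \<le> 2"
  shows "idn A k x \<in> cell A (k + 1)" "src A (k + 1) (idn A k x) = x" "tgt A (k + 1) (idn A k x) = x"
  using assms unfolding reflexive_globular_set_def by auto

lemma unit2_in_loops2:
  assumes "reflexive_globular_set A" "p \<in> cell A 0"
  shows "unit2 A p \<in> loops2 A p"
  using reflexive_globular_set_idn[OF assms]
    reflexive_globular_set_idn[OF assms(1), of "idn A 0 p" 1]
  by (simp add: loops2_def)

lemma idn_in_loops3:
  assumes "reflexive_globular_set A" "x \<in> loops2 A p"
  shows "idn A 2 x \<in> loops3 A p" "src A 3 (idn A 2 x) = x" "tgt A 3 (idn A 2 x) = x"
  using reflexive_globular_set_idn[OF assms(1), of x 2] assms(2)
  by (simp_all add: loops2_def loops3_def)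

text \<open>Used for the unit, \<phi> and \<theta>: identities go to identities, so the image of the
  base point alone says where loops go.\<close>

lemma rgset_map_loops:
  assumes "rgset_map A B f" "reflexive_globular_set A" "p \<in> cell A 0"
  shows rgset_map_loops2: "x \<in> loops2 A p \<Longrightarrow> f 2 x \<in> loops2 B (f 0 p)"
    and rgset_map_loops3: "y \<in> loops3 A p \<Longrightarrow> f 3 y \<in> loops3 B (f 0 p)"
    and rgset_map_unit2: "f 2 (unit2 A p) = unit2 B (f 0 p)"
proof -
  have src: "f (k - 1) (src A k x) = src B k (f k x)" "f (k - 1) (tgt A k x) = tgt B k (f k x)"
    if "k \<in> {1..3}" "x \<in> cell A k" for k x
    using assms that unfolding rgset_map_def by auto
  have id: "f (k + 1) (idn A k x) = idn B k (f k x)" if "k \<le> 2" "x \<in> cell A k" for k x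
    using assms that unfolding rgset_map_def by auto
  have cell: "f k x \<in> cell B k" if "k \<le> 3" "x \<in> cell A k" for k x
    using assms that unfolding rgset_map_def by auto
  have p1: "idn A 0 p \<in> cell A 1"
    using reflexive_globular_set_idn[OF assms(2,3)] by simp
  show *: "f 2 x \<in> loops2 B (f 0 p)" if "x \<in> loops2 A p" for x
    using that src[of 2 x] id[of 0 p] cell[of 2 x] assms(3) by (auto simp: loops2_def)
  show "f 3 y \<in> loops3 B (f 0 p)" if "y \<in> loops3 A p"
    using that src[of 3 y] *[of "src A 3 y"] *[of "tgt A 3 y"] cell[of 3 y]
    by (auto simp: loops3_def)
  show "f 2 (unit2 A p) = unit2 B (f 0 p)"
    using id[of 0 p] id[of 1 "idn A 0 p"] p1 assms(3) by simp
qed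

lemma iterated_boundary:
  "isrc A m 1 x = src A m x" "itgt A m 1 x = tgt A m x"
  "isrc A m 2 x = src A (m - 1) (src A m x)" "itgt A m 2 x = tgt A (m - 1) (tgt A m x)"
  "isrc A m 3 x = src A (m - 2) (src A (m - 1) (src A m x))"
  "itgt A m 3 x = tgt A (m - 2) (tgt A (m - 1) (tgt A m x))"
  "iidn A k 1 y = idn A k y" "iidn A k 2 y = idn A (k + 1) (idn A k y)"
  "iidn A k 3 y = idn A (k + 2) (idn A (k + 1) (idn A k y))"
  by (simp_all add: numeral_2_eq_2 numeral_3_eq_3 One_nat_def
      del: One_nat_def[symmetric])

section \<open>Composability of loops\<close>

lemma composable_iff:
  "composable A 2 1 \<beta> \<alpha> \<longleftrightarrow> \<beta> \<in> cell A 2 \<and> \<alpha> \<in> cell A 2 \<and> tgt A 2 \<alpha> = src A 2 \<beta>"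
  "composable A 3 2 \<beta> \<alpha> \<longleftrightarrow> \<beta> \<in> cell A 3 \<and> \<alpha> \<in> cell A 3 \<and> tgt A 3 \<alpha> = src A 3 \<beta>"
  "composable A 3 1 \<beta> \<alpha> \<longleftrightarrow>
     \<beta> \<in> cell A 3 \<and> \<alpha> \<in> cell A 3 \<and> tgt A 2 (tgt A 3 \<alpha>) = src A 2 (src A 3 \<beta>)"
  "composable A 2 0 \<beta> \<alpha> \<longleftrightarrow>
     \<beta> \<in> cell A 2 \<and> \<alpha> \<in> cell A 2 \<and> tgt A 1 (tgt A 2 \<alpha>) = src A 1 (src A 2 \<beta>)"
  "composable A 3 0 \<beta> \<alpha> \<longleftrightarrow> \<beta> \<in> cell A 3 \<and> \<alpha> \<in> cell A 3 \<and>
     tgt A 1 (tgt A 2 (tgt A 3 \<alpha>)) = src A 1 (src A 2 (src A 3 \<beta>))"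
  unfolding composable_def using iterated_boundary[of A] by simp_all

lemma composable_loops2:
  assumes "x \<in> loops2 A p" "y \<in> loops2 A p"
  shows "composable A 2 1 x y"
  using assms by (simp add: composable_iff loops2_def)

lemma composable_loops3:
  assumes "f \<in> loops3 A p" "g \<in> loops3 A p"
  shows "composable A 3 1 f g"
  using assms by (simp add: composable_iff loops2_def loops3_def)

text \<open>Both ends of \<open>idn A 0 p\<close> are \<open>p\<close>, so any two loops are also
  composable along the point. This second direction of composition is what interchange is played
  against.\<close>

lemma composable_loops_0:
  assumes "reflexive_globular_set A" "p \<in> cell A 0"
  shows composable_loops2_0: "\<lbrakk>x \<in> loops2 A p; y \<in> loops2 A p\<rbrakk> \<Longrightarrow> composable A 2 0 x y"
    and composable_loops3_0: "\<lbrakk>f \<in> loops3 A p; g \<in> loops3 A p\<rbrakk> \<Longrightarrow> composable A 3 0 f g"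
  using reflexive_globular_set_idn[OF assms]
  by (simp_all add: composable_iff loops2_def loops3_def)

section \<open>Closure of loops under composition in a magma\<close>

context
  fixes A :: "'u magma"
  assumes magma: "is_magma A"
begin

lemma magma_cmp_cell:
  assumes "composable A m k \<beta> \<alpha>" "k < m" "m \<le> 3"
  shows "cmp A m k \<beta> \<alpha> \<in> cell A m"
  using magma[unfolded is_magma_def, THEN conjunct2, rule_format, of m k \<beta> \<alpha>] assms
  by simp

lemma magma_cmp_boundary:
  assumes "composable A m k \<beta> \<alpha>" "k < m - 1" "m \<le> 3"
  shows "src A m (cmp A m k \<beta> \<alpha>) = cmp A (m - 1) k (src A m \<beta>) (src A m \<alpha>)"
    "tgt A m (cmp A m k \<beta> \<alpha>) = cmp A (m - 1) k (tgt A m \<beta>) (tgt A m \<alpha>)"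
  using magma[unfolded is_magma_def, THEN conjunct2, rule_format, of m k \<beta> \<alpha>] assms
  by simp_all

lemma magma_cmp_boundary_top:
  assumes "composable A m k \<beta> \<alpha>" "k = m - 1" "1 \<le> m" "m \<le> 3"
  shows "src A m (cmp A m k \<beta> \<alpha>) = src A m \<alpha>" "tgt A m (cmp A m k \<beta> \<alpha>) = tgt A m \<beta>"
  using magma[unfolded is_magma_def, THEN conjunct2, rule_format, of m k \<beta> \<alpha>] assms
  by simp_all

lemma loops2_cmp:
  assumes "x \<in> loops2 A p" "y \<in> loops2 A p"
  shows "cmp A 2 1 x y \<in> loops2 A p"
  using magma_cmp_cell[OF composable_loops2[OF assms]]
    magma_cmp_boundary_top[OF composable_loops2[OF assms]] assms
  by (simp add: loops2_def)

lemma loops3_cmp_1: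
  assumes "f \<in> loops3 A p" "g \<in> loops3 A p"
  shows "cmp A 3 1 f g \<in> loops3 A p"
    "src A 3 (cmp A 3 1 f g) = cmp A 2 1 (src A 3 f) (src A 3 g)"
    "tgt A 3 (cmp A 3 1 f g) = cmp A 2 1 (tgt A 3 f) (tgt A 3 g)"
proof -
  note c = composable_loops3[OF assms]
  show "src A 3 (cmp A 3 1 f g) = cmp A 2 1 (src A 3 f) (src A 3 g)"
    "tgt A 3 (cmp A 3 1 f g) = cmp A 2 1 (tgt A 3 f) (tgt A 3 g)"
    using magma_cmp_boundary[OF c] by simp_all
  then show "cmp A 3 1 f g \<in> loops3 A p"
    using magma_cmp_cell[OF c] assms loops2_cmp by (simp add: loops3_def)
qed

lemma loops3_cmp_2:
  assumes "f \<in> loops3 A p" "g \<in> loops3 A p" "tgt A 3 f = src A 3 g"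
  shows "cmp A 3 2 g f \<in> loops3 A p"
    "src A 3 (cmp A 3 2 g f) = src A 3 f" "tgt A 3 (cmp A 3 2 g f) = tgt A 3 g"
proof -
  have c: "composable A 3 2 g f"
    using assms by (simp add: composable_iff loops3_def)
  show "src A 3 (cmp A 3 2 g f) = src A 3 f" "tgt A 3 (cmp A 3 2 g f) = tgt A 3 g"
    using magma_cmp_boundary_top[OF c] by simp_all
  then show "cmp A 3 2 g f \<in> loops3 A p"
    using magma_cmp_cell[OF c] assms by (simp add: loops3_def)
qed

end

section \<open>Eckmann--Hilton in a strict 3-category\<close>

locale pointed_strict_3_category =
  fixes T :: "'u magma" and p :: 'u
  assumes strict: "strict_3_category T" and point: "p \<in> cell T 0"
begin

lemma magma: "is_magma T"
  using strict by (simp add: strict_3_category_def)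

lemma rgset: "reflexive_globular_set T"
  using magma by (simp add: is_magma_def)

lemma assoc:
  assumes "composable T m k \<beta> \<alpha>" "composable T m k \<gamma> \<beta>" "k < m" "m \<le> 3"
  shows "cmp T m k (cmp T m k \<gamma> \<beta>) \<alpha> = cmp T m k \<gamma> (cmp T m k \<beta> \<alpha>)"
proof -
  have "\<forall>m\<in>{1..3}. \<forall>k<m. \<forall>\<alpha> \<beta> \<gamma>. composable T m k \<beta> \<alpha> \<and> composable T m k \<gamma> \<beta> \<longrightarrow>
      cmp T m k (cmp T m k \<gamma> \<beta>) \<alpha> = cmp T m k \<gamma> (cmp T m k \<beta> \<alpha>)"
    using strict unfolding strict_3_category_def by (elim conjE)
  from this[rule_format, of m k \<beta> \<alpha> \<gamma>] show ?thesis
    using assms by simp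
qed

lemma unit:
  assumes "\<alpha> \<in> cell T m" "k < m" "m \<le> 3"
  shows "cmp T m k \<alpha> (iidn T k (m - k) (isrc T m (m - k) \<alpha>)) = \<alpha>"
    "cmp T m k (iidn T k (m - k) (itgt T m (m - k) \<alpha>)) \<alpha> = \<alpha>"
proof -
  have "\<forall>m\<in>{1..3}. \<forall>k<m. \<forall>\<alpha>\<in>cell T m.
      cmp T m k \<alpha> (iidn T k (m - k) (isrc T m (m - k) \<alpha>)) = \<alpha> \<and>
      cmp T m k (iidn T k (m - k) (itgt T m (m - k) \<alpha>)) \<alpha> = \<alpha>"
    using strict unfolding strict_3_category_def by (elim conjE)
  from this[rule_format, of m k \<alpha>]
  show "cmp T m k \<alpha> (iidn T k (m - k) (isrc T m (m - k) \<alpha>)) = \<alpha>"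
    "cmp T m k (iidn T k (m - k) (itgt T m (m - k) \<alpha>)) \<alpha> = \<alpha>"
    using assms by simp_all
qed

lemma interchange:
  assumes "composable T m k \<beta> \<alpha>" "composable T m k \<delta> \<gamma>"
    "composable T m j \<gamma> \<alpha>" "composable T m j \<delta> \<beta>" "j < k" "k < m" "m \<le> 3"
  shows "cmp T m j (cmp T m k \<delta> \<gamma>) (cmp T m k \<beta> \<alpha>) =
    cmp T m k (cmp T m j \<delta> \<beta>) (cmp T m j \<gamma> \<alpha>)"
proof -
  have "\<forall>m\<in>{1..3}. \<forall>k<m. \<forall>j<k. \<forall>\<alpha> \<beta> \<gamma> \<delta>.
      composable T m k \<beta> \<alpha> \<and> composable T m k \<delta> \<gamma> \<and>
      composable T m j \<gamma> \<alpha> \<and> composable T m j \<delta> \<beta> \<longrightarrow>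
      cmp T m j (cmp T m k \<delta> \<gamma>) (cmp T m k \<beta> \<alpha>) =
      cmp T m k (cmp T m j \<delta> \<beta>) (cmp T m j \<gamma> \<alpha>)"
    using strict unfolding strict_3_category_def by (elim conjE)
  from this[rule_format, of m k j \<beta> \<alpha> \<delta> \<gamma>] show ?thesis
    using assms by simp
qed

lemma idn_cmp:
  assumes "x \<in> loops2 T p" "y \<in> loops2 T p"
  shows "cmp T 3 1 (idn T 2 x) (idn T 2 y) = idn T 2 (cmp T 2 1 x y)"
proof -
  have "\<forall>m\<in>{1..2}. \<forall>k<m. \<forall>\<alpha> \<beta>. composable T m k \<beta> \<alpha> \<longrightarrow>
      idn T m (cmp T m k \<beta> \<alpha>) = cmp T (m + 1) k (idn T m \<beta>) (idn T m \<alpha>)"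
    using strict unfolding strict_3_category_def by (elim conjE)
  from this[rule_format, of 2 1 x y] show ?thesis
    using composable_loops2[OF assms] by simp
qed

text \<open>One cell is a unit in both directions: it is the identity on the bounding 1-cell
  \<open>idn T 0 p\<close> and also the twofold identity on the point. This coincidence drives
  Eckmann--Hilton; the next lemma is the same for 3-cells.\<close>

lemma unit2_cmp:
  assumes "x \<in> loops2 T p"
  shows "cmp T 2 1 x (unit2 T p) = x" "cmp T 2 1 (unit2 T p) x = x"
    "cmp T 2 0 x (unit2 T p) = x" "cmp T 2 0 (unit2 T p) x = x"
  using unit[of x 2 1] unit[of x 2 0] assms reflexive_globular_set_idn[OF rgset point]
    iterated_boundary[of T]
  by (simp_all add: loops2_def)

lemma unit3_cmp:
  assumes "f \<in> loops3 T p"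
  shows "cmp T 3 1 f (idn T 2 (unit2 T p)) = f" "cmp T 3 1 (idn T 2 (unit2 T p)) f = f"
    "cmp T 3 0 f (idn T 2 (unit2 T p)) = f" "cmp T 3 0 (idn T 2 (unit2 T p)) f = f"
  using unit[of f 3 1] unit[of f 3 0] assms reflexive_globular_set_idn[OF rgset point]
    iterated_boundary[of T]
  by (simp_all add: loops2_def loops3_def)

text \<open>A premise ties the boundary to \<open>x\<close>, so that the rules also apply when the
  identity sits on a 2-cell only provably equal to that boundary.\<close>

lemma unit_cmp_2:
  assumes "f \<in> cell T 3"
  shows "src T 3 f = x \<Longrightarrow> cmp T 3 2 f (idn T 2 x) = f"
    "tgt T 3 f = x \<Longrightarrow> cmp T 3 2 (idn T 2 x) f = f"
  using unit[of f 3 2] assms iterated_boundary[of T] by auto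

lemma idn_cmp_2:
  assumes "x \<in> loops2 T p"
  shows "cmp T 3 2 (idn T 2 x) (idn T 2 x) = idn T 2 x"
  using unit_cmp_2(1)[of "idn T 2 x"] idn_in_loops3[OF rgset assms] by (simp add: loops3_def)

lemma loops2_assoc:
  assumes "x \<in> loops2 T p" "y \<in> loops2 T p" "z \<in> loops2 T p"
  shows "cmp T 2 1 (cmp T 2 1 x y) z = cmp T 2 1 x (cmp T 2 1 y z)"
  by (rule assoc) (use assms composable_loops2 in auto)

lemma loops3_assoc:
  assumes "x \<in> loops3 T p" "y \<in> loops3 T p" "z \<in> loops3 T p"
  shows "cmp T 3 1 (cmp T 3 1 x y) z = cmp T 3 1 x (cmp T 3 1 y z)"
  by (rule assoc) (use assms composable_loops3 in auto)

lemma loops2_commute: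
  assumes x: "x \<in> loops2 T p" and y: "y \<in> loops2 T p"
  shows "cmp T 2 1 x y = cmp T 2 1 y x"
proof -
  note u = unit2_in_loops2[OF rgset point]
  note c = composable_loops2[where A = T and p = p] composable_loops2_0[OF rgset point]
  \<comment> \<open>Interchange on a square of four cells, two of them units. With \<open>x\<close>
    and \<open>y\<close> on one diagonal it yields \<open>cmp T 2 1 x y\<close>, on the other
    \<open>cmp T 2 1 y x\<close>; both equal the composite along the point.\<close>
  have "cmp T 2 0 x y = cmp T 2 1 x y"
    using interchange[of 2 1 "unit2 T p" y x "unit2 T p" 0] c x y u unit2_cmp by simp
  moreover have "cmp T 2 0 x y = cmp T 2 1 y x"
    using interchange[of 2 1 y "unit2 T p" "unit2 T p" x 0] c x y u unit2_cmp by simp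
  ultimately show ?thesis by simp
qed

text \<open>The same squares one dimension up, with the threefold identity on the point as unit.
  Naturality of the braiding comes from this.\<close>

lemma loops3_commute:
  assumes x: "x \<in> loops3 T p" and y: "y \<in> loops3 T p"
  shows "cmp T 3 1 x y = cmp T 3 1 y x"
proof -
  define w where "w = idn T 2 (unit2 T p)"
  have u: "w \<in> loops3 T p"
    unfolding w_def by (rule idn_in_loops3[OF rgset unit2_in_loops2[OF rgset point]])
  note c = composable_loops3[where A = T and p = p] composable_loops3_0[OF rgset point]
  note [simp] = unit3_cmp[folded w_def]
  have "cmp T 3 0 x y = cmp T 3 1 x y"
    using interchange[of 3 1 w y x w 0] c x y u by simp
  moreover have "cmp T 3 0 x y = cmp T 3 1 y x"
    using interchange[of 3 1 y w w x 0] c x y u by simp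
  ultimately show ?thesis by simp
qed

lemma loops2_left_commute:
  assumes "x \<in> loops2 T p" "y \<in> loops2 T p" "z \<in> loops2 T p"
  shows "cmp T 2 1 x (cmp T 2 1 y z) = cmp T 2 1 y (cmp T 2 1 x z)"
  using assms loops2_assoc loops2_commute by metis

lemma loops3_interchange:
  assumes "f \<in> loops3 T p" "f' \<in> loops3 T p" "tgt T 3 f = src T 3 f'"
    and "g \<in> loops3 T p" "g' \<in> loops3 T p" "tgt T 3 g = src T 3 g'"
  shows "cmp T 3 1 (cmp T 3 2 f' f) (cmp T 3 2 g' g) = cmp T 3 2 (cmp T 3 1 f' g') (cmp T 3 1 f g)"
  by (rule interchange) (use assms in \<open>auto simp: composable_iff loops3_def loops2_def\<close>)

end

section \<open>Coherence in an object of Q\<close>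

text \<open>Used at two levels, \<open>F A\<close> and \<open>F (forget (F A))\<close>, because the
  algebra law compares cells formed before and after evaluation.\<close>

locale pointed_Q_object =
  fixes X :: "'u quad" and p :: 'u
  assumes Q: "Q_object X" and p: "p \<in> cell (mag X) 0"
begin

abbreviation (input) "M \<equiv> mag X"
abbreviation (input) "T \<equiv> cat X"
abbreviation (input) "\<phi> \<equiv> qmap X"

lemma M_magma: "is_magma M"
  using Q by (simp add: Q_object_def)

lemma M_rgset: "reflexive_globular_set M"
  using M_magma by (simp add: is_magma_def)

lemma \<phi>_magma_map: "magma_map M T \<phi>"
  using Q by (simp add: Q_object_def)

lemma \<phi>_rgset_map: "rgset_map M T \<phi>"
  using \<phi>_magma_map by (simp add: magma_map_def)

lemma contraction: "contraction M T \<phi> (contr X)"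
  using Q by (simp add: Q_object_def)

sublocale T: pointed_strict_3_category T "\<phi> 0 p"
  using Q p \<phi>_rgset_map by unfold_locales (auto simp: Q_object_def rgset_map_def)

lemma \<phi>_cmp:
  assumes "composable M m k \<beta> \<alpha>" "k < m" "m \<le> 3"
  shows "\<phi> m (cmp M m k \<beta> \<alpha>) = cmp T m k (\<phi> m \<beta>) (\<phi> m \<alpha>)"
  using \<phi>_magma_map[unfolded magma_map_def, THEN conjunct2, rule_format, of m k \<beta> \<alpha>] assms
  by simp

lemma \<phi>_loops2: "x \<in> loops2 M p \<Longrightarrow> \<phi> 2 x \<in> loops2 T (\<phi> 0 p)"
  and \<phi>_loops3: "f \<in> loops3 M p \<Longrightarrow> \<phi> 3 f \<in> loops3 T (\<phi> 0 p)"
  and \<phi>_unit2: "\<phi> 2 (unit2 M p) = unit2 T (\<phi> 0 p)"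
  by (rule rgset_map_loops[OF \<phi>_rgset_map M_rgset p]; assumption)+

lemma \<phi>_cmp_loops2:
  "\<lbrakk>x \<in> loops2 M p; y \<in> loops2 M p\<rbrakk> \<Longrightarrow> \<phi> 2 (cmp M 2 1 x y) = cmp T 2 1 (\<phi> 2 x) (\<phi> 2 y)"
  by (simp add: \<phi>_cmp composable_loops2)

lemma parallel_loops2:
  "\<lbrakk>x \<in> loops2 M p; y \<in> loops2 M p; \<phi> 2 x = \<phi> 2 y\<rbrakk> \<Longrightarrow> contr_pair M \<phi> 2 x y"
  by (simp add: contr_pair_def parallel_def loops2_def)

lemma contr_pair_assoc:
  assumes "x \<in> loops2 M p" "y \<in> loops2 M p" "z \<in> loops2 M p"
  shows "contr_pair M \<phi> 2 (cmp M 2 1 (cmp M 2 1 x y) z) (cmp M 2 1 x (cmp M 2 1 y z))"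
  using assms
  by (auto intro!: parallel_loops2
      simp: loops2_cmp[OF M_magma] \<phi>_cmp_loops2 T.loops2_assoc \<phi>_loops2)

lemma contr_pair_unit:
  assumes "x \<in> loops2 M p"
  shows "contr_pair M \<phi> 2 (cmp M 2 1 (unit2 M p) x) x"
    and "contr_pair M \<phi> 2 (cmp M 2 1 x (unit2 M p)) x"
  using assms unit2_in_loops2[OF M_rgset p]
  by (auto intro!: parallel_loops2
      simp: loops2_cmp[OF M_magma] \<phi>_cmp_loops2 \<phi>_unit2 T.unit2_cmp \<phi>_loops2)

lemma contr_pair_commute:
  assumes "x \<in> loops2 M p" "y \<in> loops2 M p"
  shows "contr_pair M \<phi> 2 (cmp M 2 1 x y) (cmp M 2 1 y x)"
  using assms T.loops2_commute[OF \<phi>_loops2 \<phi>_loops2]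
  by (auto intro!: parallel_loops2 simp: loops2_cmp[OF M_magma] \<phi>_cmp_loops2)

section \<open>3-cells described by source, target and image\<close>

definition arr :: "'u \<Rightarrow> 'u \<Rightarrow> 'u \<Rightarrow> 'u \<Rightarrow> bool" where
  "arr f x y v \<longleftrightarrow> f \<in> loops3 M p \<and> src M 3 f = x \<and> tgt M 3 f = y \<and> \<phi> 3 f = v"

text \<open>The clause of a contraction in dimension 3 identifies parallel cells with equal image.
  Every commuting diagram below is reduced to it.\<close>

lemma arr_eq:
  assumes "arr f x y v" "arr g x y v"
  shows "f = g"
proof -
  have "contr_pair M \<phi> 3 f g"
    using assms by (simp add: arr_def contr_pair_def parallel_def loops3_def)
  then show ?thesis
    using contraction unfolding contraction_def by blast
qed

text \<open>\<phi> preserves boundaries. In particular, if \<open>v\<close> is an identity then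
  \<open>x\<close> and \<open>y\<close> have the same image in \<open>T\<close>.\<close>

lemma arr_loops:
  assumes "arr f x y v"
  shows "x \<in> loops2 M p" "y \<in> loops2 M p" "v \<in> loops3 T (\<phi> 0 p)"
    "src T 3 v = \<phi> 2 x" "tgt T 3 v = \<phi> 2 y"
proof -
  have "f \<in> cell M 3" using assms by (simp add: arr_def loops3_def)
  then have "\<phi> 2 (src M 3 f) = src T 3 (\<phi> 3 f)" "\<phi> 2 (tgt M 3 f) = tgt T 3 (\<phi> 3 f)"
    using \<phi>_rgset_map[unfolded rgset_map_def, THEN conjunct2, THEN conjunct1, rule_format, of 3 f]
    by simp_all
  then show "src T 3 v = \<phi> 2 x" "tgt T 3 v = \<phi> 2 y"
    using assms by (auto simp: arr_def)
qed (use assms \<phi>_loops3 in \<open>auto simp: arr_def loops3_def\<close>)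

lemma arr_cell:
  assumes "f \<in> loops3 M p"
  shows "arr f (src M 3 f) (tgt M 3 f) (\<phi> 3 f)"
  using assms by (simp add: arr_def)

lemma arr_idn:
  assumes "x \<in> loops2 M p"
  shows "arr (idn M 2 x) x x (idn T 2 (\<phi> 2 x))"
  using assms idn_in_loops3[OF M_rgset assms]
    \<phi>_rgset_map[unfolded rgset_map_def, THEN conjunct2, THEN conjunct2, rule_format, of 2 x]
  by (simp add: arr_def loops2_def)

lemma arr_contr:
  assumes "contr_pair M \<phi> 2 x y" "x \<in> loops2 M p" "y \<in> loops2 M p"
  shows "arr (contr X 2 x y) x y (idn T 2 (\<phi> 2 x))"
  using contraction[unfolded contraction_def, THEN conjunct1, rule_format, of 2 x y] assms
  by (simp add: arr_def loops3_def)

lemma arr_cmp_2: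
  assumes "arr g y z w" "arr f x y v"
  shows "arr (cmp M 3 2 g f) x z (cmp T 3 2 w v)"
  using assms loops3_cmp_2[OF M_magma, of f p g] \<phi>_cmp[of 3 2 g f]
  by (auto simp: arr_def composable_iff loops3_def)

lemma arr_cmp_1:
  assumes "arr f x y v" "arr f' x' y' v'"
  shows "arr (cmp M 3 1 f f') (cmp M 2 1 x x') (cmp M 2 1 y y') (cmp T 3 1 v v')"
  using assms loops3_cmp_1[OF M_magma, of f p f'] \<phi>_cmp[of 3 1 f f']
    composable_loops3[of f M p f']
  by (auto simp: arr_def)

end

section \<open>Evaluation in an algebra\<close>

lemma left_adjoint_free:
  assumes "left_adjoint F \<eta>" "reflexive_globular_set B"
  shows "Q_object (F B)" "rgset_map B (forget (F B)) (\<eta> B)"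
  using assms unfolding left_adjoint_def by auto

lemma adjunct:
  assumes "left_adjoint F \<eta>" "reflexive_globular_set B" "Q_object X" "rgset_map B (forget X) f"
  shows "Q_morphism (F B) X (adjunct F \<eta> B X f)"
    "\<lbrakk>k \<le> 3; b \<in> cell B k\<rbrakk> \<Longrightarrow> fst (adjunct F \<eta> B X f) k (\<eta> B k b) = f k b"
proof -
  have "\<exists>g. Q_morphism (F B) X g \<and> (\<forall>k\<le>3. \<forall>a\<in>cell B k. fst g k (\<eta> B k a) = f k a)"
    using assms unfolding left_adjoint_def by blast
  from someI_ex[OF this] show "Q_morphism (F B) X (adjunct F \<eta> B X f)"
    "\<lbrakk>k \<le> 3; b \<in> cell B k\<rbrakk> \<Longrightarrow> fst (adjunct F \<eta> B X f) k (\<eta> B k b) = f k b"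
    unfolding adjunct_def by auto
qed

lemma Q_morphism_cmp:
  assumes "Q_morphism X Y g" "composable (mag X) m k \<beta> \<alpha>" "k < m" "m \<le> 3"
  shows "fst g m (cmp (mag X) m k \<beta> \<alpha>) = cmp (mag Y) m k (fst g m \<beta>) (fst g m \<alpha>)"
proof -
  have "magma_map (mag X) (mag Y) (fst g)"
    using assms(1) by (simp add: Q_morphism_def)
  from this[unfolded magma_map_def, THEN conjunct2, rule_format, of m k \<beta> \<alpha>] show ?thesis
    using assms by simp
qed

lemma Q_morphism_contr:
  assumes "Q_morphism X Y g" "contr_pair (mag X) (qmap X) k \<alpha> \<beta>" "k < 3"
  shows "fst g (k + 1) (contr X k \<alpha> \<beta>) = contr Y k (fst g k \<alpha>) (fst g k \<beta>)"
  using assms by (simp add: Q_morphism_def)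

locale doubly_degenerate_algebra =
  fixes F :: "'u rgset \<Rightarrow> 'u quad"
    and \<eta> :: "'u rgset \<Rightarrow> nat \<Rightarrow> 'u \<Rightarrow> 'u"
    and A :: "'u rgset"
    and \<theta> :: "nat \<Rightarrow> 'u \<Rightarrow> 'u"
  assumes adj: "left_adjoint F \<eta>"
    and alg: "P3_algebra F \<eta> A \<theta>"
    and deg: "doubly_degenerate A"
begin

definition "pt = (THE x. x \<in> cell A 0)"

abbreviation (input) "M \<equiv> mag (F A)"
abbreviation (input) "T \<equiv> cat (F A)"
abbreviation (input) "\<phi> \<equiv> qmap (F A)"
abbreviation (input) "PA \<equiv> forget (F A)"
abbreviation (input) "N \<equiv> mag (F PA)"
abbreviation (input) "h \<equiv> \<eta> A"
abbreviation (input) "h' \<equiv> \<eta> PA"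
abbreviation (input) "q \<equiv> h 0 pt"
abbreviation (input) "r \<equiv> \<phi> 0 q"

lemma A_rgset: "reflexive_globular_set A"
  using alg by (simp add: P3_algebra_def)

lemma pt: "pt \<in> cell A 0"
  unfolding pt_def using deg by (auto simp: doubly_degenerate_def intro: theI')

text \<open>The identity on the only 0-cell is a 1-cell, hence the only one. Thus every 2-cell of
  \<open>A\<close> is a loop, and the monoidal unit is a twofold identity.\<close>

lemma cell_1: "x \<in> cell A 1 \<longleftrightarrow> x = idn A 0 pt"
  using deg reflexive_globular_set_idn[OF A_rgset pt] unfolding doubly_degenerate_def by auto

lemma the_1_cell: "the_1_cell A = idn A 0 pt"
  unfolding the_1_cell_def cell_1 by simp

lemma cell_2: "cell A 2 = loops2 A pt"
  using reflexive_globular_set_src_tgt[OF A_rgset, of _ 2] cell_1 by (auto simp: loops2_def)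

lemma cell_3: "cell A 3 = loops3 A pt"
  using reflexive_globular_set_src_tgt[OF A_rgset, of _ 3] by (auto simp: loops3_def cell_2)

lemma h_map: "rgset_map A M h"
  using left_adjoint_free[OF adj A_rgset] by (simp add: rgset_map_def)

lemma q: "q \<in> cell M 0"
  using h_map pt by (simp add: rgset_map_def)

sublocale X: pointed_Q_object "F A" q
  using left_adjoint_free[OF adj A_rgset] q by unfold_locales

lemma PA_rgset: "reflexive_globular_set PA"
  using X.M_rgset by (simp add: reflexive_globular_set_def)

lemma h'_map: "rgset_map M N h'"
  using left_adjoint_free[OF adj PA_rgset] by (simp add: rgset_map_def)

text \<open>The algebra law equates two maps out of \<open>P3 F (P3 F A)\<close>, so contraction
  pairs have to be available at that level too.\<close>

sublocale Y: pointed_Q_object "F PA" "h' 0 q"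
  using left_adjoint_free[OF adj PA_rgset] q h'_map by unfold_locales (auto simp: rgset_map_def)

lemma \<theta>_map: "rgset_map M A \<theta>"
  using alg by (simp add: P3_algebra_def P3_def rgset_map_def)

lemma \<theta>_h [simp]: "\<lbrakk>k \<le> 3; a \<in> cell A k\<rbrakk> \<Longrightarrow> \<theta> k (h k a) = a"
  using alg by (simp add: P3_algebra_def)

text \<open>The monad multiplication at \<open>A\<close> and the image of \<theta> under the monad,
  taken as morphisms of Q and not only as globular maps. As such they preserve composites and
  contraction cells.\<close>

abbreviation (input) "mult \<equiv> adjunct F \<eta> PA (F A) (\<lambda>k x. x)"
abbreviation (input) "map\<theta> \<equiv> adjunct F \<eta> PA (F A) (\<lambda>k x. h k (\<theta> k x))"

lemma mult: "Q_morphism (F PA) (F A) mult"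
  and mult_h': "\<lbrakk>k \<le> 3; x \<in> cell M k\<rbrakk> \<Longrightarrow> fst mult k (h' k x) = x"
proof -
  have "rgset_map PA PA (\<lambda>k x. x)" by (simp add: rgset_map_def)
  note * = adjunct[OF adj PA_rgset X.Q this]
  show "Q_morphism (F PA) (F A) mult" by (rule *)
  show "\<lbrakk>k \<le> 3; x \<in> cell M k\<rbrakk> \<Longrightarrow> fst mult k (h' k x) = x" using *(2) by simp
qed

lemma map\<theta>: "Q_morphism (F PA) (F A) map\<theta>"
  and map\<theta>_h': "\<lbrakk>k \<le> 3; x \<in> cell M k\<rbrakk> \<Longrightarrow> fst map\<theta> k (h' k x) = h k (\<theta> k x)"
proof -
  have "rgset_map PA PA (\<lambda>k x. h k (\<theta> k x))"
    using rgset_map_comp[OF \<theta>_map h_map] by (simp add: rgset_map_def)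
  note * = adjunct[OF adj PA_rgset X.Q this]
  show "Q_morphism (F PA) (F A) map\<theta>" by (rule *)
  show "\<lbrakk>k \<le> 3; x \<in> cell M k\<rbrakk> \<Longrightarrow> fst map\<theta> k (h' k x) = h k (\<theta> k x)" using *(2) by simp
qed

section \<open>Evaluation of composites and contraction cells\<close>

lemma \<theta>_mult: "\<lbrakk>k \<le> 3; z \<in> cell N k\<rbrakk> \<Longrightarrow> \<theta> k (fst mult k z) = \<theta> k (fst map\<theta> k z)"
  using alg by (simp add: P3_algebra_def P3_def P3_mult_def P3_map_def)

text \<open>Apply the algebra law to the composite of \<open>h' m y\<close> and
  \<open>h' m x\<close> in \<open>N\<close>: \<open>mult\<close> sends it to the composite of
  \<open>y\<close> and \<open>x\<close>, \<open>map\<theta>\<close> to that of their evaluated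
  copies.\<close>

lemma \<theta>_cmp:
  assumes c: "composable M m k y x" and "k < m" "m \<le> 3"
  shows "\<theta> m (cmp M m k (h m (\<theta> m y)) (h m (\<theta> m x))) = \<theta> m (cmp M m k y x)"
proof -
  have c': "composable N m k (h' m y) (h' m x)"
    using composable_map[OF h'_map X.M_rgset] assms by simp
  have "x \<in> cell M m" "y \<in> cell M m" using c by (auto simp: composable_def)
  then show ?thesis
    using \<theta>_mult[OF \<open>m \<le> 3\<close> magma_cmp_cell[OF Y.M_magma c' assms(2,3)]] assms(3)
      Q_morphism_cmp[OF mult c' assms(2,3)] Q_morphism_cmp[OF map\<theta> c' assms(2,3)]
    by (simp add: mult_h' map\<theta>_h')
qed

text \<open>The same comparison for a contraction cell. The pair must be contractible already in
  \<open>F PA\<close>, before either map is applied.\<close>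

lemma \<theta>_contr:
  assumes "contr_pair N (qmap (F PA)) 2 x y"
  shows "\<theta> 3 (contr (F A) 2 (fst map\<theta> 2 x) (fst map\<theta> 2 y)) =
    \<theta> 3 (contr (F A) 2 (fst mult 2 x) (fst mult 2 y))"
proof -
  have "contr (F PA) 2 x y \<in> cell N 3"
    using Y.contraction[unfolded contraction_def, THEN conjunct1, rule_format, of 2 x y] assms
    by simp
  then show ?thesis
    using \<theta>_mult[of 3 "contr (F PA) 2 x y"] Q_morphism_contr[OF mult assms] Q_morphism_contr[OF map\<theta> assms] by simp
qed

lemma h'_loops2: "x \<in> loops2 M q \<Longrightarrow> h' 2 x \<in> loops2 N (h' 0 q)"
  by (rule rgset_map_loops[OF h'_map X.M_rgset q])

lemma map\<theta>_cmp:
  "\<lbrakk>x \<in> loops2 N (h' 0 q); y \<in> loops2 N (h' 0 q)\<rbrakk> \<Longrightarrow>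
    fst map\<theta> 2 (cmp N 2 1 x y) = cmp M 2 1 (fst map\<theta> 2 x) (fst map\<theta> 2 y)"
  and mult_cmp:
  "\<lbrakk>x \<in> loops2 N (h' 0 q); y \<in> loops2 N (h' 0 q)\<rbrakk> \<Longrightarrow>
    fst mult 2 (cmp N 2 1 x y) = cmp M 2 1 (fst mult 2 x) (fst mult 2 y)"
  using Q_morphism_cmp[OF map\<theta> composable_loops2] Q_morphism_cmp[OF mult composable_loops2]
  by simp_all

lemma h_unit2: "h 2 (unit2 A pt) = unit2 M q"
  by (rule rgset_map_loops[OF h_map A_rgset pt])

lemma \<theta>_unit2: "\<theta> 2 (unit2 M q) = unit2 A pt"
  using rgset_map_unit2[OF \<theta>_map X.M_rgset q] pt by simp

lemma h'_unit2: "h' 2 (unit2 M q) = unit2 N (h' 0 q)"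
  by (rule rgset_map_loops[OF h'_map X.M_rgset q])

lemmas loops2_simps = map\<theta>_cmp mult_cmp map\<theta>_h' mult_h' h'_loops2 loops2_cmp[OF Y.M_magma]

lemma loops2_cell: "x \<in> loops2 B b \<Longrightarrow> x \<in> cell B 2"
  by (simp add: loops2_def)

abbreviation (input) "\<theta>\<theta> x \<equiv> h 2 (\<theta> 2 x)"
abbreviation (input) tensor (infixr "\<odot>" 70) where "x \<odot> y \<equiv> cmp M 2 1 x y"

text \<open>Here \<open>x\<close>, \<open>y\<close>, \<open>z\<close> may be composites. The pair in
  \<open>N\<close> is built from the generators \<open>h' 2 x\<close>, \<open>h' 2 y\<close>,
  \<open>h' 2 z\<close>, which \<open>mult\<close> returns to \<open>x\<close>, \<open>y\<close>,
  \<open>z\<close> and \<open>map\<theta>\<close> sends to their evaluated copies.\<close>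

lemma \<theta>_assoc:
  assumes "x \<in> loops2 M q" "y \<in> loops2 M q" "z \<in> loops2 M q"
  shows "\<theta> 3 (contr (F A) 2 ((\<theta>\<theta> x \<odot> \<theta>\<theta> y) \<odot> \<theta>\<theta> z) (\<theta>\<theta> x \<odot> \<theta>\<theta> y \<odot> \<theta>\<theta> z)) =
    \<theta> 3 (contr (F A) 2 ((x \<odot> y) \<odot> z) (x \<odot> y \<odot> z))"
  using \<theta>_contr[OF Y.contr_pair_assoc[OF assms[THEN h'_loops2]]] assms
  by (simp add: loops2_simps loops2_cell)

text \<open>Eckmann--Hilton in \<open>cat (F PA)\<close> provides the contraction cell in
  \<open>F PA\<close> whose two images are compared.\<close>

lemma \<theta>_commute:
  assumes "x \<in> loops2 M q" "y \<in> loops2 M q"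
  shows "\<theta> 3 (contr (F A) 2 (\<theta>\<theta> x \<odot> \<theta>\<theta> y) (\<theta>\<theta> y \<odot> \<theta>\<theta> x)) = \<theta> 3 (contr (F A) 2 (x \<odot> y) (y \<odot> x))"
  using \<theta>_contr[OF Y.contr_pair_commute[OF assms[THEN h'_loops2]]] assms
  by (simp add: loops2_simps loops2_cell)

lemma \<theta>_unit:
  assumes "x \<in> loops2 M q"
  shows "\<theta> 3 (contr (F A) 2 (unit2 M q \<odot> \<theta>\<theta> x) (\<theta>\<theta> x)) = \<theta> 3 (contr (F A) 2 (unit2 M q \<odot> x) x)"
    and "\<theta> 3 (contr (F A) 2 (\<theta>\<theta> x \<odot> unit2 M q) (\<theta>\<theta> x)) = \<theta> 3 (contr (F A) 2 (x \<odot> unit2 M q) x)"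
  using \<theta>_contr[OF Y.contr_pair_unit(1)[OF assms[THEN h'_loops2]]]
    \<theta>_contr[OF Y.contr_pair_unit(2)[OF assms[THEN h'_loops2]]] assms
    unit2_in_loops2[OF X.M_rgset q] h_unit2
  \<comment> \<open>The unit of \<open>N\<close> is written as a generator so that both maps can be
    evaluated on it; evaluation followed by \<open>h\<close> leaves \<open>unit2 M q\<close>
    fixed.\<close>
  by (simp_all add: h'_unit2[symmetric] loops2_simps loops2_cell \<theta>_unit2)

subsection \<open>The braided monoidal category\<close>

abbreviation "C \<equiv> algebra_data F \<eta> A \<theta>"

lemma C_simps:
  "Obj C = loops2 A pt" "Mor C = loops3 A pt" "Dom C = src A 3" "Cod C = tgt A 3" "Ident C = idn A 2"
  "Unit C = unit2 A pt"
  "Comp C m n = \<theta> 3 (cmp M 3 2 (h 3 m) (h 3 n))"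
  "TensorO C a b = \<theta> 2 (h 2 a \<odot> h 2 b)"
  "TensorM C m n = \<theta> 3 (cmp M 3 1 (h 3 m) (h 3 n))"
  "Assoc C a b c = \<theta> 3 (contr (F A) 2 ((h 2 a \<odot> h 2 b) \<odot> h 2 c) (h 2 a \<odot> h 2 b \<odot> h 2 c))"
  "LUnit C a = \<theta> 3 (contr (F A) 2 (unit2 M q \<odot> h 2 a) (h 2 a))"
  "RUnit C a = \<theta> 3 (contr (F A) 2 (h 2 a \<odot> unit2 M q) (h 2 a))"
  "Braid C a b = \<theta> 3 (contr (F A) 2 (h 2 a \<odot> h 2 b) (h 2 b \<odot> h 2 a))"
  by (simp_all add: algebra_data_def Let_def cell_2 cell_3 the_1_cell h_unit2)

text \<open>
  \<open>obj a x\<close> and \<open>mor m x y v\<close> say that a cell of \<open>A\<close> is the value of a cell of \<open>P\<^sub>3A\<close>, where \<open>v\<close> is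
  the image in \<open>T\<^sub>RA\<close> of a 3-cell from \<open>x\<close> to \<open>y\<close>. Since \<open>x\<close>, \<open>y\<close> and \<open>v\<close> determine the 3-cell, they
  determine \<open>m\<close>.
\<close>

definition obj :: "'u \<Rightarrow> 'u \<Rightarrow> bool" where
  "obj a x \<longleftrightarrow> x \<in> loops2 M q \<and> \<theta> 2 x = a"

definition mor :: "'u \<Rightarrow> 'u \<Rightarrow> 'u \<Rightarrow> 'u \<Rightarrow> bool" where
  "mor m x y v \<longleftrightarrow> (\<exists>f. X.arr f x y v \<and> \<theta> 3 f = m)"

text \<open>Reduces an equation of morphisms in \<open>C\<close> to one in \<open>T\<close>. Keeping
  \<open>v = w\<close> as a separate premise lets resolution find the ends and values first and
  leaves only this equation to compute.\<close>

lemma mor_eq: "\<lbrakk>mor m x y v; mor n x y w; v = w\<rbrakk> \<Longrightarrow> m = n"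
  unfolding mor_def using X.arr_eq by blast

lemma mor_loops:
  assumes "mor m x y v"
  shows "x \<in> loops2 M q" "y \<in> loops2 M q" "v \<in> loops3 T r" "src T 3 v = \<phi> 2 x" "tgt T 3 v = \<phi> 2 y"
  using assms X.arr_loops unfolding mor_def by blast+

lemma obj_loops: "obj a x \<Longrightarrow> x \<in> loops2 M q"
  by (simp add: obj_def)

section \<open>Representing the structure of \<open>C\<close> by cells of the free object\<close>

lemma in_hom_mor:
  assumes "mor m x y v" "obj a x" "obj b y"
  shows "in_hom C m a b"
proof -
  from assms(1) obtain f where f: "f \<in> loops3 M q" "src M 3 f = x" "tgt M 3 f = y" "\<theta> 3 f = m"
    unfolding mor_def X.arr_def by blast
  have "m \<in> loops3 A pt"
    using rgset_map_loops3[OF \<theta>_map X.M_rgset q f(1)] f(4) pt by simp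
  moreover have "\<theta> 2 x = src A 3 m" "\<theta> 2 y = tgt A 3 m"
    using \<theta>_map[unfolded rgset_map_def, THEN conjunct2, THEN conjunct1, rule_format, of 3 f] f
    by (auto simp: loops3_def)
  ultimately show ?thesis
    using assms by (simp add: in_hom_def C_simps obj_def)
qed

lemma obj_h:
  assumes "a \<in> Obj C"
  shows "obj a (h 2 a)"
  using assms rgset_map_loops2[OF h_map A_rgset pt] cell_2 by (simp add: obj_def C_simps)

lemma mor_h:
  assumes "m \<in> Mor C"
  shows "mor m (h 2 (Dom C m)) (h 2 (Cod C m)) (\<phi> 3 (h 3 m))"
proof -
  have "h 3 m \<in> loops3 M q"
    using assms rgset_map_loops3[OF h_map A_rgset pt] by (simp add: C_simps)
  moreover have "h 2 (src A 3 m) = src M 3 (h 3 m)" "h 2 (tgt A 3 m) = tgt M 3 (h 3 m)"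
    using h_map[unfolded rgset_map_def, THEN conjunct2, THEN conjunct1, rule_format, of 3 m] assms
    by (simp_all add: C_simps cell_3)
  ultimately show ?thesis
    using X.arr_cell[of "h 3 m"] assms cell_3 unfolding mor_def C_simps by auto
qed

lemma obj_Unit: "obj (Unit C) (unit2 M q)"
  using unit2_in_loops2[OF X.M_rgset q] \<theta>_unit2 by (simp add: obj_def C_simps)

text \<open>By \<open>\<theta>_cmp\<close>, inner tensor products need not be evaluated before the
  outer one is formed, so a nested product is represented by a plain nested composite in
  \<open>M\<close>.\<close>

lemma obj_TensorO:
  assumes "obj a x" "obj b y"
  shows "obj (TensorO C a b) (x \<odot> y)"
proof -
  have "x \<in> loops2 M q" "y \<in> loops2 M q" using assms by (simp_all add: obj_def)
  then show ?thesis
    using assms \<theta>_cmp[OF composable_loops2, of x q y] loops2_cmp[OF X.M_magma]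
    by (auto simp: obj_def C_simps)
qed

lemma mor_Ident:
  assumes "obj a x"
  shows "mor (Ident C a) x x (idn T 2 (\<phi> 2 x))"
proof -
  have "\<theta> 3 (idn M 2 x) = idn A 2 a"
    using \<theta>_map[unfolded rgset_map_def, THEN conjunct2, THEN conjunct2, rule_format, of 2 x] assms
    by (simp add: obj_def loops2_def)
  then show ?thesis
    using X.arr_idn[of x] assms by (auto simp: mor_def obj_def C_simps)
qed

lemma mor_Comp:
  assumes "mor n y z w" "mor m x y v"
  shows "mor (Comp C n m) x z (cmp T 3 2 w v)"
proof -
  from assms obtain f g where fg: "X.arr g y z w" "X.arr f x y v" "\<theta> 3 g = n" "\<theta> 3 f = m"
    unfolding mor_def by blast
  then have "composable M 3 2 g f"
    by (auto simp: X.arr_def composable_iff loops3_def)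
  then show ?thesis
    using X.arr_cmp_2[OF fg(1,2)] \<theta>_cmp[of 3 2 g f] fg(3,4) by (auto simp: mor_def C_simps)
qed

lemma mor_TensorM:
  assumes "mor m x y v" "mor m' x' y' v'"
  shows "mor (TensorM C m m') (x \<odot> x') (y \<odot> y') (cmp T 3 1 v v')"
proof -
  from assms obtain f g where fg: "X.arr f x y v" "X.arr g x' y' v'" "\<theta> 3 f = m" "\<theta> 3 g = m'"
    unfolding mor_def by blast
  then have "composable M 3 1 f g"
    using composable_loops3[of f M q g] by (auto simp: X.arr_def)
  then show ?thesis
    using X.arr_cmp_1[OF fg(1,2)] \<theta>_cmp[of 3 1 f g] fg(3,4) by (auto simp: mor_def C_simps)
qed

lemma mor_contr:
  assumes "contr_pair M \<phi> 2 x y" "x \<in> loops2 M q" "y \<in> loops2 M q"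
  shows "mor (\<theta> 3 (contr (F A) 2 x y)) x y (idn T 2 (\<phi> 2 x))"
  using X.arr_contr[OF assms] by (auto simp: mor_def)

text \<open>The constraint is defined through the \<open>h\<close>-images of \<open>a\<close>,
  \<open>b\<close>, \<open>c\<close>; \<open>\<theta>_assoc\<close> permits any representatives
  instead, in particular the composites that stand for tensor products.\<close>

lemma mor_Assoc:
  assumes "obj a x" "obj b y" "obj c z"
  shows "mor (Assoc C a b c) ((x \<odot> y) \<odot> z) (x \<odot> y \<odot> z) (idn T 2 (\<phi> 2 ((x \<odot> y) \<odot> z)))"
  using assms mor_contr[OF X.contr_pair_assoc[of x y z]] \<theta>_assoc[of x y z]
  by (auto simp: obj_def C_simps loops2_cmp[OF X.M_magma])

lemma mor_LUnit:
  assumes "obj a x"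
  shows "mor (LUnit C a) (unit2 M q \<odot> x) x (idn T 2 (\<phi> 2 (unit2 M q \<odot> x)))"
  using assms mor_contr[OF X.contr_pair_unit(1)[of x]] \<theta>_unit(1)[of x]
    unit2_in_loops2[OF X.M_rgset q]
  by (auto simp: obj_def C_simps loops2_cmp[OF X.M_magma])

lemma mor_RUnit:
  assumes "obj a x"
  shows "mor (RUnit C a) (x \<odot> unit2 M q) x (idn T 2 (\<phi> 2 (x \<odot> unit2 M q)))"
  using assms mor_contr[OF X.contr_pair_unit(2)[of x]] \<theta>_unit(2)[of x]
    unit2_in_loops2[OF X.M_rgset q]
  by (auto simp: obj_def C_simps loops2_cmp[OF X.M_magma])

lemma mor_Braid:
  assumes "obj a x" "obj b y"
  shows "mor (Braid C a b) (x \<odot> y) (y \<odot> x) (idn T 2 (\<phi> 2 (x \<odot> y)))"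
  using assms mor_contr[OF X.contr_pair_commute[of x y]] \<theta>_commute[of x y]
  by (auto simp: obj_def C_simps loops2_cmp[OF X.M_magma])

text \<open>One rule per operation of \<open>C\<close>: resolving with them along an expression
  computes the source, target and value of a cell representing it.\<close>

lemmas mor_intros = mor_Comp mor_TensorM mor_Ident mor_Assoc mor_LUnit mor_RUnit mor_Braid

lemmas obj_intros = obj_TensorO obj_Unit

lemma \<phi>_tensor [simp]:
  "\<lbrakk>x \<in> loops2 M q; y \<in> loops2 M q\<rbrakk> \<Longrightarrow> \<phi> 2 (x \<odot> y) = cmp T 2 1 (\<phi> 2 x) (\<phi> 2 y)"
  by (rule X.\<phi>_cmp_loops2)

lemma T_cmp_loops2 [simp]:
  "\<lbrakk>x \<in> loops2 T r; y \<in> loops2 T r\<rbrakk> \<Longrightarrow> cmp T 2 1 x y \<in> loops2 T r"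
  by (rule loops2_cmp[OF X.T.magma])

lemma T_idn [simp]: "x \<in> loops2 T r \<Longrightarrow> idn T 2 x \<in> loops3 T r"
  by (rule idn_in_loops3[OF X.T.rgset])

lemma loops3_cell: "f \<in> loops3 T r \<Longrightarrow> f \<in> cell T 3"
  by (simp add: loops3_def)

lemmas value_simps = loops2_cmp[OF X.M_magma] X.\<phi>_loops2 unit2_in_loops2[OF X.M_rgset q] X.\<phi>_unit2
  unit2_in_loops2[OF X.T.rgset X.T.point]
  X.T.unit2_cmp X.T.idn_cmp X.T.idn_cmp_2 X.T.unit_cmp_2 X.T.unit3_cmp
  idn_in_loops3[OF X.T.rgset, of _ r] loops3_cell loops3_cmp_1[OF X.T.magma, of _ r]

text \<open>Commutativity on loops turns composition along 1-cells into an AC operation, so ordered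
  rewriting decides whether two products of 2-cells in \<open>T\<close> agree.\<close>

lemmas value_ac = X.T.loops2_assoc X.T.loops2_commute X.T.loops2_left_commute

lemma Dom_Cod_Obj: "f \<in> Mor C \<Longrightarrow> Dom C f \<in> Obj C" "f \<in> Mor C \<Longrightarrow> Cod C f \<in> Obj C"
  by (simp_all add: C_simps loops3_def)

section \<open>The category axioms\<close>

lemma category: "is_category C"
  unfolding is_category_def
proof (intro conjI ballI impI)
  fix f assume f: "f \<in> Mor C"
  show "Dom C f \<in> Obj C" "Cod C f \<in> Obj C"
    using f by (rule Dom_Cod_Obj)+
  note m = mor_h[OF f] and o = Dom_Cod_Obj[OF f, THEN obj_h]
  show "Comp C f (Ident C (Dom C f)) = f"
    by (rule mor_eq[OF mor_Comp[OF m mor_Ident[OF o(1)]] m])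
      (rule X.T.unit_cmp_2(1)[OF loops3_cell[OF mor_loops(3)[OF m]] mor_loops(4)[OF m]])
  show "Comp C (Ident C (Cod C f)) f = f"
    by (rule mor_eq[OF mor_Comp[OF mor_Ident[OF o(2)] m] m])
      (rule X.T.unit_cmp_2(2)[OF loops3_cell[OF mor_loops(3)[OF m]] mor_loops(5)[OF m]])
  fix g assume g: "g \<in> Mor C"
  { assume eq: "Cod C f = Dom C g"
    show "in_hom C (Comp C g f) (Dom C f) (Cod C g)"
      by (rule in_hom_mor[OF mor_Comp[OF mor_h[OF g] m[unfolded eq]] o(1) obj_h])
        (rule Dom_Cod_Obj[OF g]) }
  fix k assume k: "k \<in> Mor C"
  assume eq: "Cod C f = Dom C g \<and> Cod C g = Dom C k"
  \<comment> \<open>The middle objects are renamed so that the chosen representatives of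
    \<open>f\<close>, \<open>g\<close>, \<open>k\<close> have literally matching ends in
    \<open>M\<close>.\<close>
  note mg = mor_h[OF g, folded eq[THEN conjunct1]] and mk = mor_h[OF k, folded eq[THEN conjunct2]]
  show "Comp C k (Comp C g f) = Comp C (Comp C k g) f"
    by (rule mor_eq[OF mor_Comp[OF mk mor_Comp[OF mg m]] mor_Comp[OF mor_Comp[OF mk mg] m]],
        rule X.T.assoc[symmetric])
      (auto simp: composable_iff loops3_cell mor_loops[OF mg] mor_loops[OF mk] mor_loops[OF m])
next
  fix a assume "a \<in> Obj C"
  then show "in_hom C (Ident C a) a a"
    using in_hom_mor mor_Ident obj_h by blast
qed

text \<open>A cell over an identity has ends with equal image, so a contraction cell in the opposite
  direction exists. Both round trips lie over identities and are therefore identities.\<close>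

lemma coherence_mor_iso:
  assumes m: "mor m x y (idn T 2 (\<phi> 2 x))" and a: "obj a x" "obj b y"
  shows "iso_in_hom C m a b" "mor (Inverse C m) y x (idn T 2 (\<phi> 2 y))"
proof -
  have x: "x \<in> loops2 M q" "y \<in> loops2 M q" using a by (simp_all add: obj_def)
  have \<phi>: "\<phi> 2 x = \<phi> 2 y"
    using mor_loops(5)[OF m] idn_in_loops3(3)[OF X.T.rgset X.\<phi>_loops2[OF x(1)]] by simp
  define n where "n = \<theta> 3 (contr (F A) 2 y x)"
  have n: "mor n y x (idn T 2 (\<phi> 2 y))"
    unfolding n_def by (rule mor_contr[OF X.parallel_loops2]) (simp_all add: x \<phi>)
  have nm: "Comp C n m = Ident C a"
    by (rule mor_eq[OF mor_Comp[OF n m] mor_Ident[OF a(1)]])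
      (simp add: \<phi> x X.\<phi>_loops2 X.T.idn_cmp_2)
  have mn: "Comp C m n = Ident C b"
    by (rule mor_eq[OF mor_Comp[OF m n] mor_Ident[OF a(2)]])
      (simp add: \<phi> x X.\<phi>_loops2 X.T.idn_cmp_2)
  have hom: "in_hom C m a b" "in_hom C n b a"
    using in_hom_mor m n a by blast+
  then show "iso_in_hom C m a b"
    using mn nm unfolding iso_in_hom_def by blast
  have "Inverse C m = n"
    unfolding Inverse_def
  proof (rule the_equality)
    show "in_hom C n (Cod C m) (Dom C m) \<and> Comp C n m = Ident C (Dom C m) \<and>
        Comp C m n = Ident C (Cod C m)"
      using hom mn nm by (simp add: in_hom_def)
    fix g
    assume g: "in_hom C g (Cod C m) (Dom C m) \<and> Comp C g m = Ident C (Dom C m) \<and>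
        Comp C m g = Ident C (Cod C m)"
    have "Comp C g (Comp C m n) = Comp C (Comp C g m) n"
      using category g hom unfolding is_category_def in_hom_def by metis
    then show "g = n"
      using category g hom mn unfolding is_category_def in_hom_def by metis
  qed
  with n show "mor (Inverse C m) y x (idn T 2 (\<phi> 2 y))" by simp
qed

text \<open>Supplies the rule for inverse associators needed in the second hexagon.\<close>

lemma mor_Inverse_Assoc:
  assumes "obj a x" "obj b y" "obj c z"
  shows "mor (Inverse C (Assoc C a b c)) (x \<odot> y \<odot> z) ((x \<odot> y) \<odot> z) (idn T 2 (\<phi> 2 (x \<odot> y \<odot> z)))"
  by (rule coherence_mor_iso(2)[OF mor_Assoc]; (rule obj_intros assms)+)

section \<open>Functoriality of the tensor product\<close>

lemma tensor_bifunctor: "tensor_bifunctor C"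
  unfolding tensor_bifunctor_def
proof (intro conjI ballI impI)
  fix a b assume "a \<in> Obj C" "b \<in> Obj C"
  note o = this[THEN obj_h]
  \<comment> \<open>Read off as the domain of the identity on the tensor product, which is known to
    be a morphism.\<close>
  show "TensorO C a b \<in> Obj C"
    using in_hom_mor[OF mor_Ident] obj_TensorO[OF o] category
    unfolding is_category_def in_hom_def by metis
  show "TensorM C (Ident C a) (Ident C b) = Ident C (TensorO C a b)"
    by (rule mor_eq[OF mor_TensorM[OF mor_Ident mor_Ident] mor_Ident[OF obj_TensorO]]; (rule o)?)
      (simp add: value_simps o[THEN obj_loops])
next
  fix f g assume fg: "f \<in> Mor C" "g \<in> Mor C"
  note m = fg[THEN mor_h]
    and o = fg[THEN Dom_Cod_Obj(1), THEN obj_h] fg[THEN Dom_Cod_Obj(2), THEN obj_h]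
  show "in_hom C (TensorM C f g) (TensorO C (Dom C f) (Dom C g)) (TensorO C (Cod C f) (Cod C g))"
    by (rule in_hom_mor[OF mor_TensorM[OF m]]; (rule obj_intros o)+)
  fix f' g' assume fg': "f' \<in> Mor C" "g' \<in> Mor C"
    and eq: "Cod C f = Dom C f' \<and> Cod C g = Dom C g'"
  note m' = fg'[THEN mor_h, folded eq[THEN conjunct1] eq[THEN conjunct2]]
  show "TensorM C (Comp C f' f) (Comp C g' g) = Comp C (TensorM C f' g') (TensorM C f g)"
    by (rule mor_eq[OF mor_TensorM[OF mor_Comp[OF m'(1) m(1)] mor_Comp[OF m'(2) m(2)]]
          mor_Comp[OF mor_TensorM[OF m'] mor_TensorM[OF m]]], rule X.T.loops3_interchange)
      (simp_all add: m[THEN mor_loops(3)] m'[THEN mor_loops(3)] m[THEN mor_loops(4)]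
        m'[THEN mor_loops(4)] m[THEN mor_loops(5)] m'[THEN mor_loops(5)])
qed

section \<open>The monoidal structure\<close>

lemma monoidal: "monoidal_category C"
  unfolding monoidal_category_def
proof (intro conjI ballI impI)
  show "is_category C" "tensor_bifunctor C" by (rule category tensor_bifunctor)+
  show "Unit C \<in> Obj C" using unit2_in_loops2[OF A_rgset pt] by (simp add: C_simps)
next
  fix a b c assume abc: "a \<in> Obj C" "b \<in> Obj C" "c \<in> Obj C"
  note o = abc[THEN obj_h]
  show "iso_in_hom C (Assoc C a b c)
          (TensorO C (TensorO C a b) c) (TensorO C a (TensorO C b c))"
    by (rule coherence_mor_iso(1)[OF mor_Assoc]; (rule obj_intros o)+)
  fix d assume d: "d \<in> Obj C"
  note o = o obj_h[OF d]
  show "Comp C (Assoc C a b (TensorO C c d)) (Assoc C (TensorO C a b) c d) =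
        Comp C (TensorM C (Ident C a) (Assoc C b c d))
          (Comp C (Assoc C a (TensorO C b c) d) (TensorM C (Assoc C a b c) (Ident C d)))"
    \<comment> \<open>Both sides of the pentagon are represented by cells with the same ends in
      \<open>M\<close>, and all factors lie over identities; only the products of 2-cells carrying
      these have to be matched.\<close>
    by (rule mor_eq, (rule mor_intros obj_intros o)+)
      (simp add: value_simps value_ac o[THEN obj_loops])
next
  fix a assume "a \<in> Obj C"
  note o = obj_h[OF this]
  show "iso_in_hom C (LUnit C a) (TensorO C (Unit C) a) a"
    by (rule coherence_mor_iso(1)[OF mor_LUnit]; (rule obj_intros o)+)
  show "iso_in_hom C (RUnit C a) (TensorO C a (Unit C)) a"
    by (rule coherence_mor_iso(1)[OF mor_RUnit]; (rule obj_intros o)+)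
next
  fix f g k assume fgk: "f \<in> Mor C" "g \<in> Mor C" "k \<in> Mor C"
  note o = fgk[THEN Dom_Cod_Obj(1), THEN obj_h] fgk[THEN Dom_Cod_Obj(2), THEN obj_h]
    and m = fgk[THEN mor_h]
  show "Comp C (Assoc C (Cod C f) (Cod C g) (Cod C k)) (TensorM C (TensorM C f g) k) =
        Comp C (TensorM C f (TensorM C g k)) (Assoc C (Dom C f) (Dom C g) (Dom C k))"
    \<comment> \<open>The associators contribute identities, which are absorbed; what remains is
      associativity of the values of \<open>f\<close>, \<open>g\<close>, \<open>k\<close> in
      \<open>T\<close>.\<close>
    by (rule mor_eq, (rule mor_intros obj_intros o m)+)
      (simp add: value_simps o[THEN obj_loops] m[THEN mor_loops(3)]
        m[THEN mor_loops(4)] m[THEN mor_loops(5)] X.T.loops2_assoc X.T.loops3_assoc)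
next
  fix f assume f: "f \<in> Mor C"
  note o = f[THEN Dom_Cod_Obj(1), THEN obj_h] f[THEN Dom_Cod_Obj(2), THEN obj_h]
    and m = mor_h[OF f]
  show "Comp C (LUnit C (Cod C f)) (TensorM C (Ident C (Unit C)) f) = Comp C f (LUnit C (Dom C f))"
    by (rule mor_eq, (rule mor_intros obj_intros o m)+)
      (simp add: value_simps o[THEN obj_loops] mor_loops(3-5)[OF m])
  show "Comp C (RUnit C (Cod C f)) (TensorM C f (Ident C (Unit C))) = Comp C f (RUnit C (Dom C f))"
    by (rule mor_eq, (rule mor_intros obj_intros o m)+)
      (simp add: value_simps o[THEN obj_loops] mor_loops(3-5)[OF m])
next
  fix a b assume "a \<in> Obj C" "b \<in> Obj C"
  note o = this[THEN obj_h]
  show "Comp C (TensorM C (Ident C a) (LUnit C b)) (Assoc C a (Unit C) b) =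
        TensorM C (RUnit C a) (Ident C b)"
    by (rule mor_eq, (rule mor_intros obj_intros o)+)
      (simp add: value_simps value_ac o[THEN obj_loops])
qed

section \<open>Braiding and symmetry\<close>

lemma braided: "braided_monoidal_category C"
  unfolding braided_monoidal_category_def
proof (intro conjI ballI impI)
  show "monoidal_category C" by (rule monoidal)
next
  fix a b assume "a \<in> Obj C" "b \<in> Obj C"
  note o = this[THEN obj_h]
  show "iso_in_hom C (Braid C a b) (TensorO C a b) (TensorO C b a)"
    by (rule coherence_mor_iso(1)[OF mor_Braid]; (rule obj_intros o)+)
next
  fix f g assume fg: "f \<in> Mor C" "g \<in> Mor C"
  note o = fg[THEN Dom_Cod_Obj(1), THEN obj_h] fg[THEN Dom_Cod_Obj(2), THEN obj_h]
    and m = fg[THEN mor_h]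
  show "Comp C (Braid C (Cod C f) (Cod C g)) (TensorM C f g) =
        Comp C (TensorM C g f) (Braid C (Dom C f) (Dom C g))"
    \<comment> \<open>After the identities under the braidings are absorbed, the two values are the
      products of those of \<open>f\<close> and \<open>g\<close> in either order.\<close>
    by (rule mor_eq, (rule mor_intros obj_intros o m)+)
      (simp add: value_simps value_ac o[THEN obj_loops] m[THEN mor_loops(3)]
        m[THEN mor_loops(4)] m[THEN mor_loops(5)] X.T.loops3_commute)
next
  fix a b c assume abc: "a \<in> Obj C" "b \<in> Obj C" "c \<in> Obj C"
  note o = abc[THEN obj_h]
  show "Comp C (Assoc C b c a) (Comp C (Braid C a (TensorO C b c)) (Assoc C a b c)) =
        Comp C (TensorM C (Ident C b) (Braid C a c))
          (Comp C (Assoc C b a c) (TensorM C (Braid C a b) (Ident C c)))"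
    by (rule mor_eq, (rule mor_intros obj_intros o)+)
      (simp add: value_simps value_ac o[THEN obj_loops])
  show "Comp C (Inverse C (Assoc C c a b))
          (Comp C (Braid C (TensorO C a b) c) (Inverse C (Assoc C a b c))) =
        Comp C (TensorM C (Braid C a c) (Ident C b))
          (Comp C (Inverse C (Assoc C a c b)) (TensorM C (Ident C a) (Braid C b c)))"
    by (rule mor_eq, (rule mor_intros mor_Inverse_Assoc obj_intros o)+)
      (simp add: value_simps value_ac o[THEN obj_loops])
qed

text \<open>The double braiding and the identity are represented by parallel cells over the same
  identity of \<open>T\<close>; uniqueness of such 3-cells leaves no room for a nontrivial double
  braiding.\<close>

lemma symmetric:
  assumes "a \<in> Obj C" "b \<in> Obj C"
  shows "Comp C (Braid C b a) (Braid C a b) = Ident C (TensorO C a b)"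
proof -
  note o = assms[THEN obj_h]
  show ?thesis
    by (rule mor_eq, (rule mor_intros obj_intros o)+)
      (simp add: value_simps value_ac o[THEN obj_loops])
qed

end

theorem mainTheorem1:
  fixes F :: "'u rgset \<Rightarrow> 'u quad"
    and \<eta> :: "'u rgset \<Rightarrow> nat \<Rightarrow> 'u \<Rightarrow> 'u"
    and A :: "'u rgset"
    and \<theta> :: "nat \<Rightarrow> 'u \<Rightarrow> 'u"
  assumes "left_adjoint F \<eta>"
    and "P3_algebra F \<eta> A \<theta>"
    and "doubly_degenerate A"
  defines "\<phi> \<equiv> qmap (F A)"
    and "o1 \<equiv> cmp (mag (F A)) 2 1"
    and "u \<equiv> idn A 1 (the_1_cell A)"
    and "C \<equiv> algebra_data F \<eta> A \<theta>"
  shows "(\<forall>\<alpha>\<in>cell A 2. \<forall>\<beta>\<in>cell A 2.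
            \<phi> 2 (o1 (\<eta> A 2 \<alpha>) (\<eta> A 2 \<beta>)) = \<phi> 2 (o1 (\<eta> A 2 \<beta>) (\<eta> A 2 \<alpha>)) \<and>
            contr_pair (mag (F A)) \<phi> 2
              (o1 (\<eta> A 2 \<alpha>) (\<eta> A 2 \<beta>)) (o1 (\<eta> A 2 \<beta>) (\<eta> A 2 \<alpha>)))
       \<and> (\<forall>\<alpha>\<in>cell A 2. \<forall>\<beta>\<in>cell A 2. \<forall>\<gamma>\<in>cell A 2.
            contr_pair (mag (F A)) \<phi> 2
              (o1 (o1 (\<eta> A 2 \<alpha>) (\<eta> A 2 \<beta>)) (\<eta> A 2 \<gamma>))
              (o1 (\<eta> A 2 \<alpha>) (o1 (\<eta> A 2 \<beta>) (\<eta> A 2 \<gamma>))))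
       \<and> (\<forall>\<alpha>\<in>cell A 2.
            contr_pair (mag (F A)) \<phi> 2 (o1 (\<eta> A 2 u) (\<eta> A 2 \<alpha>)) (\<eta> A 2 \<alpha>) \<and>
            contr_pair (mag (F A)) \<phi> 2 (o1 (\<eta> A 2 \<alpha>) (\<eta> A 2 u)) (\<eta> A 2 \<alpha>))
       \<and> braided_monoidal_category C
       \<and> (\<forall>\<alpha>\<in>cell A 2. \<forall>\<beta>\<in>cell A 2.
            Comp C (Braid C \<beta> \<alpha>) (Braid C \<alpha> \<beta>) = Ident C (TensorO C \<alpha> \<beta>))"
proof -
  interpret doubly_degenerate_algebra F \<eta> A \<theta>
    using assms(1-3) by unfold_locales
  \<comment> \<open>Every 2-cell of \<open>A\<close> is a loop at its point, and the unit map
    carries loops to loops.\<close>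
  have h: "\<eta> A 2 a \<in> loops2 (mag (F A)) (\<eta> A 0 pt)" if "a \<in> cell A 2" for a
    using that obj_h[of a] by (simp add: obj_def C_simps cell_2)
  have u: "\<eta> A 2 u = unit2 (mag (F A)) (\<eta> A 0 pt)"
    by (simp add: u_def the_1_cell h_unit2)
  have "contr_pair (mag (F A)) \<phi> 2
      (o1 (\<eta> A 2 \<alpha>) (\<eta> A 2 \<beta>)) (o1 (\<eta> A 2 \<beta>) (\<eta> A 2 \<alpha>))"
    if "\<alpha> \<in> cell A 2" "\<beta> \<in> cell A 2" for \<alpha> \<beta>
    unfolding \<phi>_def o1_def using that by (intro X.contr_pair_commute h)
  moreover from this have "\<phi> 2 (o1 (\<eta> A 2 \<alpha>) (\<eta> A 2 \<beta>)) = \<phi> 2 (o1 (\<eta> A 2 \<beta>) (\<eta> A 2 \<alpha>))"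
    if "\<alpha> \<in> cell A 2" "\<beta> \<in> cell A 2" for \<alpha> \<beta>
    using that by (simp add: contr_pair_def)
  moreover have "contr_pair (mag (F A)) \<phi> 2
      (o1 (o1 (\<eta> A 2 \<alpha>) (\<eta> A 2 \<beta>)) (\<eta> A 2 \<gamma>)) (o1 (\<eta> A 2 \<alpha>) (o1 (\<eta> A 2 \<beta>) (\<eta> A 2 \<gamma>)))"
    if "\<alpha> \<in> cell A 2" "\<beta> \<in> cell A 2" "\<gamma> \<in> cell A 2" for \<alpha> \<beta> \<gamma>
    unfolding \<phi>_def o1_def using that by (intro X.contr_pair_assoc h)
  moreover have "contr_pair (mag (F A)) \<phi> 2 (o1 (\<eta> A 2 u) (\<eta> A 2 \<alpha>)) (\<eta> A 2 \<alpha>)"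
    "contr_pair (mag (F A)) \<phi> 2 (o1 (\<eta> A 2 \<alpha>) (\<eta> A 2 u)) (\<eta> A 2 \<alpha>)"
    if "\<alpha> \<in> cell A 2" for \<alpha>
    unfolding \<phi>_def o1_def u using that by (simp_all add: X.contr_pair_unit h)
  moreover have "braided_monoidal_category C"
    unfolding C_def by (rule braided)
  moreover have "Comp C (Braid C \<beta> \<alpha>) (Braid C \<alpha> \<beta>) = Ident C (TensorO C \<alpha> \<beta>)"
    if "\<alpha> \<in> cell A 2" "\<beta> \<in> cell A 2" for \<alpha> \<beta>
    unfolding C_def using that by (intro symmetric) (simp_all add: C_simps cell_2)
  ultimately show ?thesis by blast
qed

end
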